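(* Let $k$ be an infinite field of characteristic different from $2$, let $H_4$ be the Sweedler Hopf algebra over $k$, let $a,b,c\in k$ with $a\ne0$, and let $\alpha:H_4\times H_4\to k$ be the normalized convolution-invertible two-cocycle with parameters $a,b,c$ given in the context. Then, identifying the elements $E,X^2,Y^2,T,U$ of $\mathcal Z_{H_4}^{\alpha}$ with their images under $\mu_\alpha$ in $\mathcal B_{H_4}^{\alpha}$: (a) As a $k$-algebra, $\mathcal B_{H_4}^{\alpha}$ is generated by $E^{\pm1}$, $(X^2)^{\pm1}$, $Y^2$, $T$, $U$, and is isomorphic to $\mathcal Z_{H_4}^{\alpha}[E^{-1},(X^2)^{-1}]$. (b) Any relation between the generators $E^{\pm1}$, $(X^2)^{\pm1}$, $Y^2$, $T$, $U$ of $\mathcal B_{H_4}^{\alpha}$ is a consequence of the relation $$T^2-4X^2Y^2=\frac{b^2-4ac}{a}\,E^2X^2.$$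
   Context: All algebras are associative unital $k$-algebras; unadorned tensor products are over $k$; Sweedler notation is used. Sweedler algebra: $H=H_4$ is generated by $x,y$ with $x^2=1$, $y^2=0$, $xy+yx=0$; it has basis $\{1,x,y,z\}$ with $z=xy$, and $\Delta(x)=x\otimes x$, $\Delta(y)=1\otimes y+y\otimes x$, $\Delta(z)=x\otimes z+z\otimes1$, $\varepsilon(x)=1$, $\varepsilon(y)=\varepsilon(z)=0$, $S(x)=x$, $S(y)=z$, $S(z)=-y$. The cocycle: $\alpha(1,h)=\alpha(h,1)=\varepsilon(h)$; $\alpha(x,x)=a$, $\alpha(x,y)=\alpha(x,z)=0$; $\alpha(y,x)=b$, $\alpha(y,y)=c$, $\alpha(y,z)=-c$; $\alpha(z,x)=b$, $\alpha(z,y)=c$, $\alpha(z,z)=-ac$. The twisted algebra ${}^{\alpha}H$ is $H$ with product $g\cdot_\alpha h=\sum\alpha(g_{(1)},h_{(1)})\,g_{(2)}h_{(2)}$ and coaction $\Delta$; its center is $k1$. The algebra $\mathcal B_H^{\alpha}$: let $t_H$ be a copy of the vector space $H$ (with identity map $h\mapsto t_h$), $S(t_H)=k[t_1,t_x,t_y,t_z]$ its symmetric algebra, $K_H$ the field of fractions. Let $t^{-1}:H\to K_H$, $h\mapsto t_h^{-1}$, be the unique linear map with $\sum t_{h_{(1)}}t^{-1}_{h_{(2)}}=\sum t^{-1}_{h_{(1)}}t_{h_{(2)}}=\varepsilon(h)1$; here $t_1^{-1}=1/t_1$, $t_x^{-1}=1/t_x$, $t_y^{-1}=-t_y/(t_1t_x)$,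 $t_z^{-1}=-t_z/(t_1t_x)$. Define $\sigma(g,h)=\sum t_{g_{(1)}}t_{h_{(1)}}\alpha(g_{(2)},h_{(2)})t^{-1}_{g_{(3)}h_{(3)}}$ and $\sigma^{-1}(g,h)=\sum t_{g_{(1)}h_{(1)}}\alpha^{-1}(g_{(2)},h_{(2)})t^{-1}_{g_{(3)}}t^{-1}_{h_{(3)}}$ ($\alpha^{-1}$ the convolution inverse of $\alpha$). $\mathcal B_H^{\alpha}$ is the subalgebra of $K_H$ generated by all values of $\sigma$ and $\sigma^{-1}$. The algebra $\mathcal U_H^{\alpha}$: $X_H$ is a copy of $H$ (with identity map $h\mapsto X_h$), $T(X_H)$ is the tensor algebra, free on $E=X_1$, $X=X_x$, $Y=X_y$, $Z=X_z$; it is an $H$-comodule algebra with coaction determined by $X_h\mapsto\sum X_{h_{(1)}}\otimes h_{(2)}$. $I_H({}^{\alpha}H)$ is the ideal of those $P\in T(X_H)$ killed by all algebra morphisms $T(X_H)\to{}^{\alpha}H$ that are $H$-comodule maps; $\mathcal U_H^{\alpha}=T(X_H)/I_H({}^{\alpha}H)$, and $\mathcal Z_H^{\alpha}$ is its center. The algebra morphism $X_h\mapsto\sum t_{h_{(1)}}\otimes h_{(2)}$ induces an injective algebra morphism $\mu_\alpha:\mathcal U_H^{\alpha}\to S(t_H)\otimes{}^{\alpha}H$, and $\mu_\alpha$ embeds $\mathcal Z_H^{\alpha}$ into $\mathcal B_H^{\alpha}\otimes1=\mathcal B_H^{\alpha}$. Put $T=XY+YX$ and $U=X(XZ+ZX)$.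 The elements $E$, $X^2$, $Y^2$, $T$, $U$ of $\mathcal U_H^{\alpha}$ lie in $\mathcal Z_H^{\alpha}$; explicitly $\mu_\alpha(E)=t_1$, $\mu_\alpha(X^2)=at_x^2$, $\mu_\alpha(Y^2)=at_y^2+bt_1t_y+ct_1^2$, $\mu_\alpha(T)=t_x(2at_y+bt_1)$, $\mu_\alpha(U)=at_x^2(2t_z+bt_x)$. *)

theory Defs
  imports "HOL-Algebra.Algebra" "HOL-Library.Poly_Mapping" "HOL-Library.Product_Plus"
    "HOL-Computational_Algebra.Fraction_Field"
begin

section \<open>Algebras over a field\<close>

text \<open>
  The ground field \<open>k\<close> is a type \<open>'k\<close> of class \<^class>\<open>field\<close>; a unital, not necessarily
  commutative \<open>k\<close>-algebra is a record of type \<open>('k, 'a) module\<close>.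
\<close>

definition alg_hom :: "('k, 'a, 'x) module_scheme \<Rightarrow> ('k, 'b, 'y) module_scheme \<Rightarrow> ('a \<Rightarrow> 'b) set"
  where "alg_hom A B =
    {h \<in> ring_hom A B. \<forall>c. \<forall>v \<in> carrier A. h (c \<odot>\<^bsub>A\<^esub> v) = c \<odot>\<^bsub>B\<^esub> h v}"

definition alg_iso :: "('k, 'a, 'x) module_scheme \<Rightarrow> ('k, 'b, 'y) module_scheme \<Rightarrow> ('a \<Rightarrow> 'b) set"
  where "alg_iso A B = {h \<in> alg_hom A B. bij_betw h (carrier A) (carrier B)}"

text \<open>The predicate \<^const>\<open>Embedded_Algebras.subalgebra\<close> of the library only asks for a linear
  subspace, hence the following one.\<close>

definition unital_subalgebra :: "'a set \<Rightarrow> ('k, 'a, 'x) module_scheme \<Rightarrow> bool"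
  where "unital_subalgebra V A \<longleftrightarrow> subring V A \<and> (\<forall>c. \<forall>v \<in> V. c \<odot>\<^bsub>A\<^esub> v \<in> V)"

definition alg_gen :: "('k, 'a, 'x) module_scheme \<Rightarrow> 'a set \<Rightarrow> 'a set"
  where "alg_gen A G = (\<lambda>V. unital_subalgebra V A) hull G"

definition center_alg :: "('k, 'a) module \<Rightarrow> ('k, 'a) module"
  where "center_alg A = A\<lparr>carrier := {z \<in> carrier A. \<forall>v \<in> carrier A. z \<otimes>\<^bsub>A\<^esub> v = v \<otimes>\<^bsub>A\<^esub> z}\<rparr>"

definition quot_alg :: "('k, 'a) module \<Rightarrow> 'a set \<Rightarrow> ('k, 'a set) module"
  where "quot_alg A I =
    ring.extend (A Quot I)
      (module.fields (\<lambda>c C. \<Union>v\<in>C. I +>\<^bsub>A\<^esub> (c \<odot>\<^bsub>A\<^esub> v)))"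

text \<open>The localization of a commutative algebra \<open>A\<close> at a submonoid \<open>S\<close>: classes of pairs
  (numerator, denominator). As in \<^const>\<open>rcoset_mult\<close>, operations on classes are unions over
  all representatives.\<close>

definition loc_rel :: "('k, 'a) module \<Rightarrow> 'a set \<Rightarrow> (('a \<times> 'a) \<times> ('a \<times> 'a)) set"
  where "loc_rel A S =
    {((r, s), (r', s')). r \<in> carrier A \<and> s \<in> S \<and> r' \<in> carrier A \<and> s' \<in> S \<and>
       (\<exists>t\<in>S. t \<otimes>\<^bsub>A\<^esub> (r \<otimes>\<^bsub>A\<^esub> s') = t \<otimes>\<^bsub>A\<^esub> (r' \<otimes>\<^bsub>A\<^esub> s))}"

definition loc_frac :: "('k, 'a) module \<Rightarrow> 'a set \<Rightarrow> 'a \<Rightarrow> 'a \<Rightarrow> ('a \<times> 'a) set"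
  where "loc_frac A S r s = loc_rel A S `` {(r, s)}"

definition loc_alg :: "('k, 'a) module \<Rightarrow> 'a set \<Rightarrow> ('k, ('a \<times> 'a) set) module"
  where "loc_alg A S =
    \<lparr>carrier = (carrier A \<times> S) // loc_rel A S,
     monoid.mult = (\<lambda>C D. \<Union>(r, s)\<in>C. \<Union>(r', s')\<in>D. loc_frac A S (r \<otimes>\<^bsub>A\<^esub> r') (s \<otimes>\<^bsub>A\<^esub> s')),
     monoid.one = loc_frac A S \<one>\<^bsub>A\<^esub> \<one>\<^bsub>A\<^esub>,
     ring.zero = loc_frac A S \<zero>\<^bsub>A\<^esub> \<one>\<^bsub>A\<^esub>,
     ring.add = (\<lambda>C D. \<Union>(r, s)\<in>C. \<Union>(r', s')\<in>D.
              loc_frac A S (r \<otimes>\<^bsub>A\<^esub> s' \<oplus>\<^bsub>A\<^esub> r' \<otimes>\<^bsub>A\<^esub> s) (s \<otimes>\<^bsub>A\<^esub> s')),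
     smult = (\<lambda>c C. \<Union>(r, s)\<in>C. loc_frac A S (c \<odot>\<^bsub>A\<^esub> r) s)\<rparr>"

definition submonoid_gen :: "('k, 'a) module \<Rightarrow> 'a set \<Rightarrow> 'a set"
  where "submonoid_gen A G = (\<lambda>M. submonoid M A) hull G"

definition pconst :: "'k::zero \<Rightarrow> ('m::zero \<Rightarrow>\<^sub>0 'k)"
  where "pconst c = Poly_Mapping.single 0 c"

text \<open>A ring given as a type, with structure map \<open>\<iota>\<close> from the ground field.\<close>

definition type_alg :: "('k \<Rightarrow> 'r::ring_1) \<Rightarrow> ('k, 'r) module"
  where "type_alg \<iota> =
    \<lparr>carrier = UNIV, monoid.mult = (*), monoid.one = 1, ring.zero = 0, ring.add = (+),
     smult = (\<lambda>c u. \<iota> c * u)\<rparr>"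


section \<open>The Sweedler algebra\<close>

datatype sw = H1 | Hx | Hy | Hz

lemma UNIV_sw: "UNIV = {H1, Hx, Hy, Hz}"
  using sw.exhaust by auto

instance sw :: finite
  by standard (simp add: UNIV_sw)

text \<open>An arbitrary linear order on the basis; it is needed only because the library derives
  that polynomial rings are integral domains for linearly ordered variables.\<close>

fun sw_index :: "sw \<Rightarrow> nat" where
  "sw_index H1 = 0" | "sw_index Hx = 1" | "sw_index Hy = 2" | "sw_index Hz = 3"

instantiation sw :: linorder
begin
definition "g \<le> h \<longleftrightarrow> sw_index g \<le> sw_index h"
definition "g < h \<longleftrightarrow> sw_index g < sw_index h"
instance
proof
  fix g h :: sw
  show "g \<le> h \<Longrightarrow> h \<le> g \<Longrightarrow> g = h"
    by (cases g; cases h) (auto simp: less_eq_sw_def)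
qed (auto simp: less_eq_sw_def less_sw_def)
end

text \<open>
  For a \<open>k\<close>-algebra \<open>R\<close>, the tensor product of \<open>R\<close> and \<open>H\<close> is the type \<open>sw \<Rightarrow> 'r\<close>: the value at a
  basis element \<open>g\<close> is the coefficient of \<open>g\<close>. In particular \<open>H\<close> itself is \<open>sw \<Rightarrow> 'k\<close>.
\<close>

definition pure_tensor :: "'r::zero \<Rightarrow> sw \<Rightarrow> (sw \<Rightarrow> 'r)"
  where "pure_tensor u g = (\<lambda>r. if r = g then u else 0)"

fun sw_mult :: "sw \<Rightarrow> sw \<Rightarrow> (sw \<Rightarrow> 'k::ring_1)" where
  "sw_mult H1 h = pure_tensor 1 h"
| "sw_mult Hx H1 = pure_tensor 1 Hx"
| "sw_mult Hx Hx = pure_tensor 1 H1"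
| "sw_mult Hx Hy = pure_tensor 1 Hz"
| "sw_mult Hx Hz = pure_tensor 1 Hy"
| "sw_mult Hy H1 = pure_tensor 1 Hy"
| "sw_mult Hy Hx = pure_tensor (- 1) Hz"
| "sw_mult Hy Hy = (\<lambda>_. 0)"
| "sw_mult Hy Hz = (\<lambda>_. 0)"
| "sw_mult Hz H1 = pure_tensor 1 Hz"
| "sw_mult Hz Hx = pure_tensor (- 1) Hy"
| "sw_mult Hz Hy = (\<lambda>_. 0)"
| "sw_mult Hz Hz = (\<lambda>_. 0)"

text \<open>The coproduct of each basis element is a sum of pairwise distinct pure tensors of basis
  elements, all with coefficient 1, and is recorded as the set of these. A Sweedler sum
  over \<open>h\<^sub>(\<^sub>1\<^sub>)\<close>, \<open>h\<^sub>(\<^sub>2\<^sub>)\<close> is thus a sum over \<open>(h\<^sub>1, h\<^sub>2) \<in> cop h\<close>.\<close>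

fun cop :: "sw \<Rightarrow> (sw \<times> sw) set" where
  "cop H1 = {(H1, H1)}"
| "cop Hx = {(Hx, Hx)}"
| "cop Hy = {(H1, Hy), (Hy, Hx)}"
| "cop Hz = {(Hx, Hz), (Hz, H1)}"

fun counit :: "sw \<Rightarrow> 'r::zero_neq_one" where
  "counit H1 = 1" | "counit Hx = 1" | "counit Hy = 0" | "counit Hz = 0"

fun antipode :: "sw \<Rightarrow> (sw \<Rightarrow> 'k::ring_1)" where
  "antipode H1 = pure_tensor 1 H1"
| "antipode Hx = pure_tensor 1 Hx"
| "antipode Hy = pure_tensor 1 Hz"
| "antipode Hz = pure_tensor (- 1) Hy"

text \<open>The linear map \<open>\<Delta>\<close>; the outer argument of the result is the second tensor factor.\<close>

definition comult :: "(sw \<Rightarrow> 'k::comm_monoid_add) \<Rightarrow> sw \<Rightarrow> (sw \<Rightarrow> 'k)"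
  where "comult u q p = (\<Sum>s\<in>UNIV. if (p, q) \<in> cop s then u s else 0)"

lemma sum_sw: "(\<Sum>s\<in>UNIV. f s) = f H1 + f Hx + f Hy + f Hz"
  for f :: "sw \<Rightarrow> 'a::comm_monoid_add"
  by (simp add: UNIV_sw add.assoc)

lemma sw_mult_assoc:
  "(\<Sum>s\<in>UNIV. sw_mult g h s * sw_mult s l r) =
   (\<Sum>s\<in>UNIV. sw_mult h l s * (sw_mult g s r :: 'k::comm_ring_1))"
  by (cases g; cases h; cases l; cases r) (simp_all add: sum_sw pure_tensor_def)

lemma cop_coassoc:
  "{(p, q, r). \<exists>s. (p, s) \<in> cop h \<and> (q, r) \<in> cop s} =
   {(p, q, r). \<exists>s. (s, r) \<in> cop h \<and> (p, q) \<in> cop s}"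
  by (cases h) auto

lemma cop_counit:
  "(\<Sum>(h1, h2)\<in>cop h. pure_tensor (counit h1 :: 'k::comm_ring_1) h2 r) = pure_tensor 1 h r"
  "(\<Sum>(h1, h2)\<in>cop h. pure_tensor (counit h2 :: 'k) h1 r) = pure_tensor 1 h r"
  by (cases h; cases r; simp add: pure_tensor_def)+

lemma comult_mult:
  "comult (sw_mult g h :: sw \<Rightarrow> 'k::comm_ring_1) q p =
   (\<Sum>(g1, g2)\<in>cop g. \<Sum>(h1, h2)\<in>cop h. sw_mult g1 h1 p * sw_mult g2 h2 q)"
  by (cases g; cases h; cases p; cases q) (simp_all add: comult_def sum_sw pure_tensor_def)

lemma antipode:
  "(\<Sum>(h1, h2)\<in>cop h. \<Sum>s\<in>UNIV. antipode h1 s * sw_mult s h2 r) =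
     counit h * pure_tensor (1::'k::comm_ring_1) H1 r"
  "(\<Sum>(h1, h2)\<in>cop h. \<Sum>s\<in>UNIV. antipode h2 s * sw_mult h1 s r) =
     counit h * pure_tensor (1::'k) H1 r"
  by (cases h; cases r; simp add: sum_sw pure_tensor_def)+

text \<open>The tensor product of \<open>R\<close> (with structure map \<open>\<iota>\<close>) and the algebra on \<open>H\<close> with structure
  constants \<open>m\<close>: the coefficient of \<open>r\<close> in the product of \<open>g\<close> and \<open>h\<close> is \<open>m g h r\<close>.\<close>

definition tensor_alg ::
    "('k \<Rightarrow> 'r::ring_1) \<Rightarrow> (sw \<Rightarrow> sw \<Rightarrow> sw \<Rightarrow> 'k) \<Rightarrow> ('k, sw \<Rightarrow> 'r) module"
  where "tensor_alg \<iota> m =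
    \<lparr>carrier = UNIV,
     monoid.mult = (\<lambda>u v r. \<Sum>g\<in>UNIV. \<Sum>h\<in>UNIV. \<iota> (m g h r) * (u g * v h)),
     monoid.one = pure_tensor 1 H1,
     ring.zero = (\<lambda>_. 0),
     ring.add = (\<lambda>u v r. u r + v r),
     smult = (\<lambda>c u r. \<iota> c * u r)\<rparr>"


section \<open>The cocycle and the twisted algebra\<close>

fun alpha :: "'k \<Rightarrow> 'k \<Rightarrow> 'k \<Rightarrow> sw \<Rightarrow> sw \<Rightarrow> 'k::ring_1" where
  "alpha a b c H1 h = counit h"
| "alpha a b c Hx H1 = 1"
| "alpha a b c Hx Hx = a"
| "alpha a b c Hx Hy = 0"
| "alpha a b c Hx Hz = 0"
| "alpha a b c Hy H1 = 0"
| "alpha a b c Hy Hx = b"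
| "alpha a b c Hy Hy = c"
| "alpha a b c Hy Hz = - c"
| "alpha a b c Hz H1 = 0"
| "alpha a b c Hz Hx = b"
| "alpha a b c Hz Hy = c"
| "alpha a b c Hz Hz = - (a * c)"

lemma alpha_cocycle:
  "(\<Sum>(g1, g2)\<in>cop g. \<Sum>(h1, h2)\<in>cop h. \<Sum>s\<in>UNIV.
      alpha a b c g1 h1 * sw_mult g2 h2 s * alpha a b c s l) =
   (\<Sum>(h1, h2)\<in>cop h. \<Sum>(l1, l2)\<in>cop l. \<Sum>s\<in>UNIV.
      alpha a b c h1 l1 * sw_mult h2 l2 s * (alpha a b c g s :: 'k::comm_ring_1))"
  by (cases g; cases h; cases l) (simp_all add: sum_sw pure_tensor_def)

definition conv2 :: "(sw \<Rightarrow> sw \<Rightarrow> 'k::ring_1) \<Rightarrow> (sw \<Rightarrow> sw \<Rightarrow> 'k) \<Rightarrow> sw \<Rightarrow> sw \<Rightarrow> 'k"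
  where "conv2 f f' g h = (\<Sum>(g1, g2)\<in>cop g. \<Sum>(h1, h2)\<in>cop h. f g1 h1 * f' g2 h2)"

definition is_conv_inverse2 :: "(sw \<Rightarrow> sw \<Rightarrow> 'k::ring_1) \<Rightarrow> (sw \<Rightarrow> sw \<Rightarrow> 'k) \<Rightarrow> bool"
  where "is_conv_inverse2 f f' \<longleftrightarrow>
    (\<forall>g h. conv2 f f' g h = counit g * counit h \<and> conv2 f' f g h = counit g * counit h)"

definition alpha_inv :: "'k \<Rightarrow> 'k \<Rightarrow> 'k \<Rightarrow> sw \<Rightarrow> sw \<Rightarrow> 'k::ring_1"
  where "alpha_inv a b c = (THE f'. is_conv_inverse2 (alpha a b c) f')"

lemma conv2_assoc:
  "conv2 (conv2 f f') f'' g h = conv2 f (conv2 f' f'') g (h::sw)"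
  for f :: "sw \<Rightarrow> sw \<Rightarrow> 'k::comm_ring_1"
  by (cases g; cases h) (simp_all add: conv2_def algebra_simps)

lemma conv2_counit:
  "conv2 (\<lambda>g h. counit g * counit h) f = f" "conv2 f (\<lambda>g h. counit g * counit h) = f"
  for f :: "sw \<Rightarrow> sw \<Rightarrow> 'k::comm_ring_1"
  by (intro ext, rename_tac g h, case_tac g; case_tac h; simp add: conv2_def)+

lemma is_conv_inverse2_unique:
  fixes f :: "sw \<Rightarrow> sw \<Rightarrow> 'k::comm_ring_1"
  assumes "is_conv_inverse2 f f1" "is_conv_inverse2 f f2"
  shows "f1 = f2"
proof -
  have "conv2 (conv2 f1 f) f2 = conv2 f1 (conv2 f f2)"
    by (intro ext conv2_assoc)
  moreover have "conv2 f1 f = (\<lambda>g h. counit g * counit h)" "conv2 f f2 = (\<lambda>g h. counit g * counit h)"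
    using assms by (auto simp: is_conv_inverse2_def intro!: ext)
  ultimately show ?thesis by (simp add: conv2_counit)
qed

lemma is_conv_inverse2_alpha_inv:
  fixes a b c :: "'k::field"
  assumes "a \<noteq> 0"
  shows "is_conv_inverse2 (alpha a b c) (alpha_inv a b c)"
proof -
  define f' where "f' g h =
    (case (g, h) of (Hx, Hx) \<Rightarrow> 1 / a | (Hy, Hx) \<Rightarrow> - b / a | (Hz, Hx) \<Rightarrow> - b / a
      | (Hy, Hy) \<Rightarrow> - c / a | (Hy, Hz) \<Rightarrow> c | (Hz, Hy) \<Rightarrow> - c | (Hz, Hz) \<Rightarrow> c
      | _ \<Rightarrow> counit g * (if g = Hx \<and> h \<noteq> H1 then 0 else counit h))" for g h
  have "is_conv_inverse2 (alpha a b c) f'"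
    unfolding is_conv_inverse2_def
  proof (intro allI)
    fix g h
    show "conv2 (alpha a b c) f' g h = counit g * counit h \<and>
          conv2 f' (alpha a b c) g h = counit g * counit h"
      using assms by (cases g; cases h) (simp_all add: conv2_def f'_def field_simps)
  qed
  then show ?thesis
    unfolding alpha_inv_def by (metis theI is_conv_inverse2_unique)
qed

definition twisted_mult :: "'k \<Rightarrow> 'k \<Rightarrow> 'k \<Rightarrow> sw \<Rightarrow> sw \<Rightarrow> (sw \<Rightarrow> 'k::ring_1)"
  where "twisted_mult a b c g h r =
    (\<Sum>(g1, g2)\<in>cop g. \<Sum>(h1, h2)\<in>cop h. alpha a b c g1 h1 * sw_mult g2 h2 r)"

lemma twisted_mult_assoc:
  "(\<Sum>s\<in>UNIV. twisted_mult a b c g h s * twisted_mult a b c s l r) =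
   (\<Sum>s\<in>UNIV. twisted_mult a b c h l s * (twisted_mult a b c g s r :: 'k::comm_ring_1))"
  by (cases g; cases h; cases l; cases r)
    (simp_all add: sum_sw pure_tensor_def twisted_mult_def algebra_simps)

definition twisted_alg :: "'k \<Rightarrow> 'k \<Rightarrow> 'k \<Rightarrow> ('k::field, sw \<Rightarrow> 'k) module"
  where "twisted_alg a b c = tensor_alg (\<lambda>k. k) (twisted_mult a b c)"


section \<open>The algebra generated by the values of the generic cocycle\<close>

type_synonym 'k St = "(sw \<Rightarrow>\<^sub>0 nat) \<Rightarrow>\<^sub>0 'k"
type_synonym 'k KH = "'k St fract"

definition tvar :: "sw \<Rightarrow> 'k::comm_ring_1 St"
  where "tvar s = Poly_Mapping.single (Poly_Mapping.single s 1) 1"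

definition St_to_KH :: "'k::field St \<Rightarrow> 'k KH"
  where "St_to_KH p = Fract p 1"

definition KH_const :: "'k::field \<Rightarrow> 'k KH"
  where "KH_const c = St_to_KH (pconst c)"

definition KH_alg :: "('k::field, 'k KH) module"
  where "KH_alg = type_alg KH_const"

definition t_gen :: "sw \<Rightarrow> 'k::field KH"
  where "t_gen s = St_to_KH (tvar s)"

definition is_t_inverse :: "(sw \<Rightarrow> 'k::field KH) \<Rightarrow> bool"
  where "is_t_inverse t' \<longleftrightarrow>
    (\<forall>h. (\<Sum>(h1, h2)\<in>cop h. t_gen h1 * t' h2) = counit h \<and>
         (\<Sum>(h1, h2)\<in>cop h. t' h1 * t_gen h2) = counit h)"

definition t_inv :: "sw \<Rightarrow> 'k::field KH"
  where "t_inv = (THE t'. is_t_inverse t')"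

lemma t_gen_nonzero: "t_gen s \<noteq> 0"
proof -
  have "tvar s \<noteq> (0 :: 'a St)"
    unfolding tvar_def by (metis lookup_single_eq lookup_zero zero_neq_one)
  then show ?thesis
    by (simp add: t_gen_def St_to_KH_def Zero_fract_def eq_fract)
qed

lemma t_inv_eqs:
  "is_t_inverse (t_inv :: sw \<Rightarrow> 'k::field KH)"
  "t_inv H1 = 1 / (t_gen H1 :: 'k KH)"
  "t_inv Hx = 1 / (t_gen Hx :: 'k KH)"
  "t_inv Hy = - t_gen Hy / (t_gen H1 * t_gen Hx :: 'k KH)"
  "t_inv Hz = - t_gen Hz / (t_gen H1 * t_gen Hx :: 'k KH)"
proof -
  define t' :: "sw \<Rightarrow> 'k KH" where "t' s =
    (case s of H1 \<Rightarrow> 1 / t_gen H1 | Hx \<Rightarrow> 1 / t_gen Hx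
      | _ \<Rightarrow> - t_gen s / (t_gen H1 * t_gen Hx))" for s
  have 1: "is_t_inverse t'"
    unfolding is_t_inverse_def
  proof (intro allI)
    fix h
    show "(\<Sum>(h1, h2)\<in>cop h. t_gen h1 * t' h2) = counit h \<and>
          (\<Sum>(h1, h2)\<in>cop h. t' h1 * t_gen h2) = counit h"
      by (cases h) (simp_all add: t'_def t_gen_nonzero field_simps)
  qed
  have 2: "f = t'" if f: "is_t_inverse f" for f
  proof
    have "t_gen H1 * f H1 = 1" "t_gen Hx * f Hx = 1"
      using f[unfolded is_t_inverse_def, rule_format, of H1]
        f[unfolded is_t_inverse_def, rule_format, of Hx] by auto
    then have *: "f H1 = 1 / t_gen H1" "f Hx = 1 / t_gen Hx"
      by (simp_all add: t_gen_nonzero field_simps)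
    have "t_gen H1 * f Hy + t_gen Hy * f Hx = 0" "t_gen Hx * f Hz + t_gen Hz * f H1 = 0"
      using f[unfolded is_t_inverse_def, rule_format, of Hy]
        f[unfolded is_t_inverse_def, rule_format, of Hz] by auto
    then have "t_gen H1 * f Hy = - (t_gen Hy * f Hx)" "t_gen Hx * f Hz = - (t_gen Hz * f H1)"
      by (simp_all add: eq_neg_iff_add_eq_0)
    then have "f Hy = - (t_gen Hy * f Hx) / t_gen H1" "f Hz = - (t_gen Hz * f H1) / t_gen Hx"
      by (metis nonzero_mult_div_cancel_left t_gen_nonzero)+
    with * show "f s = t' s" for s
      by (cases s) (simp_all add: t'_def mult.commute)
  qed
  have 3: "t_inv = t'"
    unfolding t_inv_def using 1 2 by (rule the_equality)
  show "is_t_inverse (t_inv :: sw \<Rightarrow> 'k::field KH)"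
    "t_inv H1 = 1 / (t_gen H1 :: 'k KH)"
    "t_inv Hx = 1 / (t_gen Hx :: 'k KH)"
    "t_inv Hy = - t_gen Hy / (t_gen H1 * t_gen Hx :: 'k KH)"
    "t_inv Hz = - t_gen Hz / (t_gen H1 * t_gen Hx :: 'k KH)"
    unfolding 3 using 1 by (simp_all add: t'_def)
qed

definition lin_ext :: "(sw \<Rightarrow> 'k::field KH) \<Rightarrow> (sw \<Rightarrow> 'k) \<Rightarrow> 'k KH"
  where "lin_ext f u = (\<Sum>s\<in>UNIV. KH_const (u s) * f s)"

definition bilin_ext :: "(sw \<Rightarrow> sw \<Rightarrow> 'k::field KH) \<Rightarrow> (sw \<Rightarrow> 'k) \<Rightarrow> (sw \<Rightarrow> 'k) \<Rightarrow> 'k KH"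
  where "bilin_ext f u v = (\<Sum>g\<in>UNIV. \<Sum>h\<in>UNIV. KH_const (u g * v h) * f g h)"

definition sigma :: "'k::field \<Rightarrow> 'k \<Rightarrow> 'k \<Rightarrow> sw \<Rightarrow> sw \<Rightarrow> 'k KH"
  where "sigma a b c g h =
    (\<Sum>(g1, g')\<in>cop g. \<Sum>(g2, g3)\<in>cop g'. \<Sum>(h1, h')\<in>cop h. \<Sum>(h2, h3)\<in>cop h'.
       t_gen g1 * t_gen h1 * KH_const (alpha a b c g2 h2) * lin_ext t_inv (sw_mult g3 h3))"

definition sigma_inv :: "'k::field \<Rightarrow> 'k \<Rightarrow> 'k \<Rightarrow> sw \<Rightarrow> sw \<Rightarrow> 'k KH"
  where "sigma_inv a b c g h =
    (\<Sum>(g1, g')\<in>cop g. \<Sum>(g2, g3)\<in>cop g'. \<Sum>(h1, h')\<in>cop h. \<Sum>(h2, h3)\<in>cop h'.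
       lin_ext t_gen (sw_mult g1 h1) * KH_const (alpha_inv a b c g2 h2) * t_inv g3 * t_inv h3)"

definition BH :: "'k::field \<Rightarrow> 'k \<Rightarrow> 'k \<Rightarrow> 'k KH set"
  where "BH a b c = alg_gen KH_alg
    ({bilin_ext (sigma a b c) u v |u v. True} \<union> {bilin_ext (sigma_inv a b c) u v |u v. True})"

definition BH_alg :: "'k::field \<Rightarrow> 'k \<Rightarrow> 'k \<Rightarrow> ('k, 'k KH) module"
  where "BH_alg a b c = KH_alg\<lparr>carrier := BH a b c\<rparr>"


section \<open>The universal comodule algebra\<close>

text \<open>Free monoids, written additively, so that the free algebra is the monoid algebra provided by
  \<^type>\<open>poly_mapping\<close>; its multiplication is concatenation of words.\<close>

datatype 'a fmon = FMon (letters: "'a list")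

instantiation fmon :: (type) monoid_add
begin
definition "0 = FMon []"
definition "u + v = FMon (letters u @ letters v)"
instance
  by standard (simp_all add: zero_fmon_def plus_fmon_def)
end

type_synonym 'k TX = "sw fmon \<Rightarrow>\<^sub>0 'k"

definition Xvar :: "sw \<Rightarrow> 'k::field TX"
  where "Xvar s = Poly_Mapping.single (FMon [s]) 1"

definition TX_alg :: "('k::field, 'k TX) module"
  where "TX_alg = type_alg pconst"

text \<open>The algebra morphism from the free algebra to \<open>A\<close> with given values on the generators.\<close>

definition free_lift :: "('k::field, 'b) module \<Rightarrow> (sw \<Rightarrow> 'b) \<Rightarrow> 'k TX \<Rightarrow> 'b"
  where "free_lift A f P =
    (\<Oplus>\<^bsub>A\<^esub>w \<in> Poly_Mapping.keys P.
       Poly_Mapping.lookup P w \<odot>\<^bsub>A\<^esub> foldr (\<lambda>s v. f s \<otimes>\<^bsub>A\<^esub> v) (letters w) \<one>\<^bsub>A\<^esub>)"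

definition cogen :: "(sw \<Rightarrow> 'r::ring_1) \<Rightarrow> sw \<Rightarrow> (sw \<Rightarrow> 'r)"
  where "cogen u h r = (\<Sum>(h1, h2)\<in>cop h. pure_tensor (u h1) h2 r)"

definition TX_coaction :: "'k::field TX \<Rightarrow> (sw \<Rightarrow> 'k TX)"
  where "TX_coaction = free_lift (tensor_alg pconst sw_mult) (cogen Xvar)"

definition comodule_alg_homs :: "'k::field \<Rightarrow> 'k \<Rightarrow> 'k \<Rightarrow> ('k TX \<Rightarrow> sw \<Rightarrow> 'k) set"
  where "comodule_alg_homs a b c =
    {f \<in> alg_hom TX_alg (twisted_alg a b c). \<forall>P. comult (f P) = (\<lambda>q. f (TX_coaction P q))}"

definition IH :: "'k::field \<Rightarrow> 'k \<Rightarrow> 'k \<Rightarrow> 'k TX set"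
  where "IH a b c = {P. \<forall>f \<in> comodule_alg_homs a b c. f P = (\<lambda>_. 0)}"

definition UH_alg :: "'k::field \<Rightarrow> 'k \<Rightarrow> 'k \<Rightarrow> ('k, 'k TX set) module"
  where "UH_alg a b c = quot_alg TX_alg (IH a b c)"

definition ZH_alg :: "'k::field \<Rightarrow> 'k \<Rightarrow> 'k \<Rightarrow> ('k, 'k TX set) module"
  where "ZH_alg a b c = center_alg (UH_alg a b c)"

definition UH_class :: "'k::field \<Rightarrow> 'k \<Rightarrow> 'k \<Rightarrow> 'k TX \<Rightarrow> 'k TX set"
  where "UH_class a b c P = IH a b c +>\<^bsub>TX_alg\<^esub> P"

definition mu_free :: "'k::field \<Rightarrow> 'k \<Rightarrow> 'k \<Rightarrow> 'k TX \<Rightarrow> (sw \<Rightarrow> 'k St)"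
  where "mu_free a b c = free_lift (tensor_alg pconst (twisted_mult a b c)) (cogen tvar)"

definition mu :: "'k::field \<Rightarrow> 'k \<Rightarrow> 'k \<Rightarrow> 'k TX set \<Rightarrow> (sw \<Rightarrow> 'k St)"
  where "mu a b c C = the_elem (mu_free a b c ` C)"

text \<open>The element \<open>q\<close> of \<open>K\<^sub>H\<close> with which a central element is identified: its image under
  \<open>\<mu>\<^sub>\<alpha>\<close> is the tensor product of \<open>q\<close> and \<open>1\<close>.\<close>

definition ident :: "'k::field \<Rightarrow> 'k \<Rightarrow> 'k \<Rightarrow> 'k TX set \<Rightarrow> 'k KH"
  where "ident a b c C = (THE q. (\<lambda>r. St_to_KH (mu a b c C r)) = pure_tensor q H1)"

definition U_E :: "'k::field \<Rightarrow> 'k \<Rightarrow> 'k \<Rightarrow> 'k TX set"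
  where "U_E a b c = UH_class a b c (Xvar H1)"

definition U_X2 :: "'k::field \<Rightarrow> 'k \<Rightarrow> 'k \<Rightarrow> 'k TX set"
  where "U_X2 a b c = UH_class a b c (Xvar Hx ^ 2)"

definition U_Y2 :: "'k::field \<Rightarrow> 'k \<Rightarrow> 'k \<Rightarrow> 'k TX set"
  where "U_Y2 a b c = UH_class a b c (Xvar Hy ^ 2)"

definition U_T :: "'k::field \<Rightarrow> 'k \<Rightarrow> 'k \<Rightarrow> 'k TX set"
  where "U_T a b c = UH_class a b c (Xvar Hx * Xvar Hy + Xvar Hy * Xvar Hx)"

definition U_U :: "'k::field \<Rightarrow> 'k \<Rightarrow> 'k \<Rightarrow> 'k TX set"
  where "U_U a b c = UH_class a b c (Xvar Hx * (Xvar Hx * Xvar Hz + Xvar Hz * Xvar Hx))"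


section \<open>Relations between the generators\<close>

text \<open>Formal expressions in \<open>E\<^sup>\<plusminus>\<^sup>1\<close>, \<open>(X\<^sup>2)\<^sup>\<plusminus>\<^sup>1\<close>, \<open>Y\<^sup>2\<close>, \<open>T\<close>, \<open>U\<close>: polynomials that may involve negative
  powers of the first two indeterminates.\<close>

type_synonym 'k Laur = "(int \<times> int \<times> nat \<times> nat \<times> nat) \<Rightarrow>\<^sub>0 'k"

definition L_E :: "'k::field Laur" where "L_E = Poly_Mapping.single (1, 0, 0, 0, 0) 1"
definition L_X2 :: "'k::field Laur" where "L_X2 = Poly_Mapping.single (0, 1, 0, 0, 0) 1"
definition L_Y2 :: "'k::field Laur" where "L_Y2 = Poly_Mapping.single (0, 0, 1, 0, 0) 1"
definition L_T :: "'k::field Laur" where "L_T = Poly_Mapping.single (0, 0, 0, 1, 0) 1"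
definition L_U :: "'k::field Laur" where "L_U = Poly_Mapping.single (0, 0, 0, 0, 1) 1"

definition Laur_alg :: "('k::field, 'k Laur) module"
  where "Laur_alg = type_alg pconst"

definition Laur_eval ::
    "'k::field KH \<Rightarrow> 'k KH \<Rightarrow> 'k KH \<Rightarrow> 'k KH \<Rightarrow> 'k KH \<Rightarrow> 'k Laur \<Rightarrow> 'k KH"
  where "Laur_eval e x2 y2 tt uu p =
    (\<Sum>(i, j, l, m, n)\<in>Poly_Mapping.keys p. KH_const (Poly_Mapping.lookup p (i, j, l, m, n)) *
       (e powi i * x2 powi j * y2 ^ l * tt ^ m * uu ^ n))"

end

(*
  Multiplication is computed in K_H (x) H through the map nu, the algebra morphism mu followed by the
  inclusion of S(t_H) into K_H. Since k is infinite, the comodule algebra morphisms to the twisted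
  algebra are exactly the specializations of nu at points of k^4, so nu is injective on U_H, and a
  class is central iff its image lies in K_H (x) 1.

  Put s = 2a t_y + b t_1 and w = 2 t_z + b t_x, so that T = t_x s and U = X^2 w. The algebra generated
  by E^{+-1}, (X^2)^{+-1}, Y^2, T, U is the even part of k[t_1^{+-1}, t_x^{+-1}, s, w] for the grading in
  which t_x and s are odd. The values of sigma and of its inverse are even by inspection. With
  v = y - (b/2a) x, the twisted algebra is graded with x and xv odd, 1 and v even, and nu(X_h) has even
  total degree, so central elements are even as well; this gives (a).

  For (b), the relation expresses Y^2 through the other generators because X^2 is invertible, and
  E, X^2, T, U are algebraically independent since they take independent values at points with t_x nonzero.
*)
theory Submission
  imports Defs "HOL-Library.Function_Algebras" "HOL-Computational_Algebra.Polynomial"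
begin

section \<open>Evaluation of monoid algebras\<close>

text \<open>The relation is a completed square: s^2 = 4 a Y^2 + (b^2 - 4 a c) E^2. Multiplying by
  t_x^2 = X^2 / a and using T = t_x s gives the equation in (b), with its constant. The element v
  completes the same square inside the twisted algebra. There x y + y x = b, so subtracting (b/2a) x
  from y makes v anticommute with x, and v^2 = -(b^2 - 4 a c) / (4 a) is a scalar. Both the grading
  and the division by 2a come from this. K_H itself is given no grading. An element u is treated as
  odd when u t_x lies in the generated algebra \<open>BB\<close>. The product of two odd elements u,
  u' is (a / X^2) (u t_x) (u' t_x), which lies in \<open>BB\<close> because X^2 is invertible there.
  Parity thus becomes a closure property that can be proved by induction on elements of the free
  algebra. In (b) the value of X^2 at a point of k^4 is a times a square, so it need not range over
  all of k. For this reason the vanishing argument for polynomials accepts any infinite set of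
  values for each variable.\<close>

lemma poly_mapping_single_induct [case_names zero single add]:
  assumes "P 0"
    and "\<And>m c. P (Poly_Mapping.single m c)"
    and "\<And>p q. P p \<Longrightarrow> P q \<Longrightarrow> P (p + q)"
  shows "P (p :: 'm \<Rightarrow>\<^sub>0 'k::comm_monoid_add)"
proof (induction p rule: update_induct)
  case (update p a c)
  have "Poly_Mapping.update a c p = p + Poly_Mapping.single a c"
    using update.hyps
    by (intro poly_mapping_eqI) (auto simp: lookup_update lookup_add lookup_single when_def in_keys_iff)
  then show ?case
    using assms update.IH by simp
qed (use assms(1) in simp)

definition lin_eval :: "('k \<Rightarrow> 'b \<Rightarrow> 'b) \<Rightarrow> ('m \<Rightarrow> 'b) \<Rightarrow> ('m \<Rightarrow>\<^sub>0 'k::zero) \<Rightarrow> 'b::ab_group_add"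
  where "lin_eval S \<phi> p = (\<Sum>m\<in>Poly_Mapping.keys p. S (Poly_Mapping.lookup p m) (\<phi> m))"

text \<open>One argument for three kinds of monomials: words, exponent vectors of S(t_H), and
  Laurent exponents. \<open>S\<close> and \<open>M\<close> are parameters because words take values
  in functions on the basis, which are multiplied by structure constants and not pointwise.\<close>

locale monoid_algebra_eval =
  fixes S :: "'k::comm_ring_1 \<Rightarrow> 'b::ab_group_add \<Rightarrow> 'b"
    and M :: "'b \<Rightarrow> 'b \<Rightarrow> 'b"
    and \<phi> :: "'m::monoid_add \<Rightarrow> 'b"
  assumes S_add_left: "S (c + d) u = S c u + S d u"
    and M_add_left: "M (u + v) w = M u w + M v w"
    and M_add_right: "M u (v + w) = M u v + M u w"
    and M_S: "M (S c u) (S d v) = S (c * d) (M u v)"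
    and \<phi>_add: "\<phi> (m + n) = M (\<phi> m) (\<phi> n)"
begin

lemma S_zero_left: "S 0 u = 0"
  using S_add_left[of 0 0 u] by simp

lemma lin_eval_superset:
  assumes "finite A" "Poly_Mapping.keys p \<subseteq> A"
  shows "lin_eval S \<phi> p = (\<Sum>m\<in>A. S (Poly_Mapping.lookup p m) (\<phi> m))"
  unfolding lin_eval_def using assms
  by (intro sum.mono_neutral_left) (auto simp: in_keys_iff S_zero_left)

lemma lin_eval_zero: "lin_eval S \<phi> 0 = 0"
  by (simp add: lin_eval_def)

lemma lin_eval_single: "lin_eval S \<phi> (Poly_Mapping.single m c) = S c (\<phi> m)"
  by (simp add: lin_eval_def S_zero_left)

lemma lin_eval_add: "lin_eval S \<phi> (p + q) = lin_eval S \<phi> p + lin_eval S \<phi> q"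
proof -
  let ?A = "Poly_Mapping.keys p \<union> Poly_Mapping.keys q"
  have "Poly_Mapping.keys (p + q) \<subseteq> ?A"
    by (rule keys_add)
  then show ?thesis
    by (simp add: lin_eval_superset[of ?A] lookup_add S_add_left sum.distrib)
qed

lemma M_zero: "M 0 v = 0" "M v 0 = 0"
  using M_add_left[of 0 0 v] M_add_right[of v 0 0] by simp_all

lemma lin_eval_mult: "lin_eval S \<phi> (p * q) = M (lin_eval S \<phi> p) (lin_eval S \<phi> q)"
proof (induction p rule: poly_mapping_single_induct)
  case (single m c)
  show ?case
  proof (induction q rule: poly_mapping_single_induct)
    case (single n d)
    show ?case
      by (simp add: mult_single lin_eval_single M_S \<phi>_add)
  qed (simp_all add: lin_eval_zero M_zero lin_eval_add distrib_left M_add_right)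
qed (simp_all add: lin_eval_zero M_zero lin_eval_add distrib_right M_add_left)

end

section \<open>Morphisms from the free algebra to twisted tensor products\<close>

definition tensor_mult :: "('k \<Rightarrow> 'r::ring_1) \<Rightarrow> (sw \<Rightarrow> sw \<Rightarrow> sw \<Rightarrow> 'k) \<Rightarrow> (sw \<Rightarrow> 'r) \<Rightarrow> (sw \<Rightarrow> 'r) \<Rightarrow> sw \<Rightarrow> 'r"
  where "tensor_mult \<iota> m u v r = (\<Sum>g\<in>UNIV. \<Sum>h\<in>UNIV. \<iota> (m g h r) * (u g * v h))"

definition word_eval :: "('k \<Rightarrow> 'r::ring_1) \<Rightarrow> (sw \<Rightarrow> sw \<Rightarrow> sw \<Rightarrow> 'k) \<Rightarrow> (sw \<Rightarrow> sw \<Rightarrow> 'r) \<Rightarrow> sw fmon \<Rightarrow> sw \<Rightarrow> 'r"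
  where "word_eval \<iota> m f w = foldr (\<lambda>s. tensor_mult \<iota> m (f s)) (letters w) (pure_tensor 1 H1)"

lemma sum_rotate3:
  "(\<Sum>h\<in>A. \<Sum>l\<in>B. \<Sum>s\<in>C. f h l s) = (\<Sum>s\<in>C. \<Sum>h\<in>A. \<Sum>l\<in>B. f h l s)"
  by (subst (2) sum.swap, subst sum.swap) simp

lemma sum_reverse4:
  "(\<Sum>s\<in>A. \<Sum>l\<in>B. \<Sum>g\<in>C. \<Sum>h\<in>D. f s l g h) = (\<Sum>g\<in>C. \<Sum>h\<in>D. \<Sum>l\<in>B. \<Sum>s\<in>A. f s l g h)"
proof -
  have "(\<Sum>s\<in>A. \<Sum>l\<in>B. \<Sum>g\<in>C. \<Sum>h\<in>D. f s l g h) = (\<Sum>l\<in>B. \<Sum>s\<in>A. \<Sum>g\<in>C. \<Sum>h\<in>D. f s l g h)"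
    by (rule sum.swap)
  also have "\<dots> = (\<Sum>l\<in>B. \<Sum>g\<in>C. \<Sum>h\<in>D. \<Sum>s\<in>A. f s l g h)"
    by (intro sum.cong refl sum_rotate3[symmetric])
  also have "\<dots> = (\<Sum>g\<in>C. \<Sum>h\<in>D. \<Sum>l\<in>B. \<Sum>s\<in>A. f s l g h)"
    by (rule sum_rotate3[symmetric])
  finally show ?thesis .
qed

text \<open>No rule of this locale is declared as a simplification rule: for the identity map they read
  \<open>1 = 1\<close> or \<open>0 = 0\<close>, on which the simplifier loops.\<close>

locale structure_hom =
  fixes \<iota> :: "'k::comm_ring_1 \<Rightarrow> 'r::ring_1"
  assumes \<iota>_one: "\<iota> 1 = 1"
    and \<iota>_add: "\<iota> (c + d) = \<iota> c + \<iota> d"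
    and \<iota>_mult: "\<iota> (c * d) = \<iota> c * \<iota> d"
    and \<iota>_central: "\<iota> c * u = u * \<iota> c"
begin

lemma \<iota>_zero: "\<iota> 0 = 0"
  using \<iota>_add[of 0 0] by simp

lemma \<iota>_mult_assoc: "\<iota> c * (\<iota> d * u) = \<iota> (c * d) * u"
  by (simp add: \<iota>_mult mult.assoc)

lemma \<iota>_left_commute: "u * (\<iota> c * v) = \<iota> c * (u * v)"
  by (simp add: \<iota>_central[of c u] mult.assoc[symmetric])

lemma \<iota>_minus: "\<iota> (- c) = - \<iota> c"
  using \<iota>_add[of c "- c"] by (simp add: eq_neg_iff_add_eq_0 add.commute \<iota>_zero)

lemma \<iota>_diff: "\<iota> (c - d) = \<iota> c - \<iota> d"
  using \<iota>_add[of c "- d"] by (simp add: \<iota>_minus)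

lemma \<iota>_sum: "\<iota> (sum f A) = (\<Sum>x\<in>A. \<iota> (f x))"
  by (induction A rule: infinite_finite_induct) (simp_all add: \<iota>_add \<iota>_zero \<iota>_one)

lemma \<iota>_numeral: "\<iota> (numeral n) = numeral n"
proof -
  have "\<iota> (of_nat k) = of_nat k" for k
    by (induction k) (simp_all add: \<iota>_add \<iota>_zero \<iota>_one)
  from this[of "numeral n"] show ?thesis by simp
qed

lemma \<iota>_power: "\<iota> (c ^ n) = \<iota> c ^ n"
  by (induction n) (simp_all add: \<iota>_mult \<iota>_one)

end

text \<open>Covers T(X_H) tensor H, where the coaction lands, and the twisted algebra with
  coefficients in k, S(t_H) or K_H. In the first case the coefficients do not commute, so only the
  scalars \<open>\<iota> c\<close> are moved past them.\<close>

locale tensor_algebra = structure_hom \<iota> for \<iota> :: "'k::field \<Rightarrow> 'r::ring_1" +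
  fixes m :: "sw \<Rightarrow> sw \<Rightarrow> sw \<Rightarrow> 'k"
  assumes m_assoc: "(\<Sum>s\<in>UNIV. m g h s * m s l r) = (\<Sum>s\<in>UNIV. m h l s * m g s r)"
    and m_one_left: "m H1 h r = (if r = h then 1 else 0)"
    and m_one_right: "m h H1 r = (if r = h then 1 else 0)"
begin

lemma tensor_mult_add_left: "tensor_mult \<iota> m (u + v) w = tensor_mult \<iota> m u w + tensor_mult \<iota> m v w"
  by (rule ext) (simp add: tensor_mult_def distrib_left distrib_right sum.distrib)

lemma tensor_mult_add_right: "tensor_mult \<iota> m w (u + v) = tensor_mult \<iota> m w u + tensor_mult \<iota> m w v"
  by (rule ext) (simp add: tensor_mult_def distrib_left sum.distrib)

lemma tensor_mult_one_left: "tensor_mult \<iota> m (pure_tensor 1 H1) u = u"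
  by (rule ext, rename_tac r, case_tac r) (simp_all add: tensor_mult_def pure_tensor_def sum_sw m_one_left \<iota>_zero \<iota>_one)

lemma tensor_mult_one_right: "tensor_mult \<iota> m u (pure_tensor 1 H1) = u"
  by (rule ext, rename_tac r, case_tac r) (simp_all add: tensor_mult_def pure_tensor_def sum_sw m_one_right \<iota>_zero \<iota>_one)

lemma tensor_mult_smult:
  "tensor_mult \<iota> m (\<lambda>r. \<iota> c * u r) (\<lambda>r. \<iota> d * v r) = (\<lambda>r. \<iota> (c * d) * tensor_mult \<iota> m u v r)"
proof (rule ext)
  fix r
  have "\<iota> (m g h r) * (\<iota> c * u g * (\<iota> d * v h)) = \<iota> (c * d) * (\<iota> (m g h r) * (u g * v h))" for g h
    by (simp add: \<iota>_left_commute[of "u g"] \<iota>_mult_assoc mult.assoc mult.commute mult.left_commute)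
  then show "tensor_mult \<iota> m (\<lambda>r. \<iota> c * u r) (\<lambda>r. \<iota> d * v r) r = \<iota> (c * d) * tensor_mult \<iota> m u v r"
    by (simp add: tensor_mult_def sum_distrib_left)
qed

lemma tensor_mult_assoc:
  "tensor_mult \<iota> m (tensor_mult \<iota> m u v) w = tensor_mult \<iota> m u (tensor_mult \<iota> m v w)"
proof (rule ext)
  fix r
  have "tensor_mult \<iota> m (tensor_mult \<iota> m u v) w r =
      (\<Sum>s\<in>UNIV. \<Sum>l\<in>UNIV. \<Sum>g\<in>UNIV. \<Sum>h\<in>UNIV. \<iota> (m g h s * m s l r) * (u g * (v h * w l)))"
  proof -
    have "\<iota> (m s l r) * (\<iota> (m g h s) * (u g * v h) * w l) = \<iota> (m g h s * m s l r) * (u g * (v h * w l))"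
      for s l g h
      by (simp add: \<iota>_left_commute[of "u g"] \<iota>_mult_assoc mult.assoc mult.commute)
    then show ?thesis
      by (simp add: tensor_mult_def sum_distrib_left sum_distrib_right)
  qed
  \<comment> \<open>With the intermediate index \<open>s\<close> innermost, the sum over
    \<open>s\<close> is the left side of \<open>m_assoc\<close>.\<close>
  also have "\<dots> = (\<Sum>g\<in>UNIV. \<Sum>h\<in>UNIV. \<Sum>l\<in>UNIV. \<Sum>s\<in>UNIV. \<iota> (m g h s * m s l r) * (u g * (v h * w l)))"
    by (rule sum_reverse4)
  also have "\<dots> = (\<Sum>g\<in>UNIV. \<Sum>h\<in>UNIV. \<Sum>l\<in>UNIV. \<iota> (\<Sum>s\<in>UNIV. m g h s * m s l r) * (u g * (v h * w l)))"
    by (simp add: \<iota>_sum sum_distrib_right)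
  also have "\<dots> = (\<Sum>g\<in>UNIV. \<Sum>h\<in>UNIV. \<Sum>l\<in>UNIV. \<Sum>s\<in>UNIV. \<iota> (m h l s * m g s r) * (u g * (v h * w l)))"
    by (simp add: m_assoc \<iota>_sum sum_distrib_right)
  also have "\<dots> = (\<Sum>g\<in>UNIV. \<Sum>s\<in>UNIV. \<Sum>h\<in>UNIV. \<Sum>l\<in>UNIV. \<iota> (m h l s * m g s r) * (u g * (v h * w l)))"
    by (intro sum.cong refl sum_rotate3)
  also have "\<dots> = tensor_mult \<iota> m u (tensor_mult \<iota> m v w) r"
  proof -
    have "\<iota> (m g s r) * (u g * (\<iota> (m h l s) * (v h * w l))) = \<iota> (m h l s * m g s r) * (u g * (v h * w l))"
      for s l g h
      by (simp add: \<iota>_left_commute[of "u g"] \<iota>_mult_assoc mult.assoc mult.commute)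
    then show ?thesis
      by (simp add: tensor_mult_def sum_distrib_left)
  qed
  finally show "tensor_mult \<iota> m (tensor_mult \<iota> m u v) w r = tensor_mult \<iota> m u (tensor_mult \<iota> m v w) r" .
qed

lemma word_eval_zero: "word_eval \<iota> m f 0 = pure_tensor 1 H1"
  by (simp add: word_eval_def zero_fmon_def)

lemma word_eval_add: "word_eval \<iota> m f (v + w) = tensor_mult \<iota> m (word_eval \<iota> m f v) (word_eval \<iota> m f w)"
proof -
  have "foldr (\<lambda>s. tensor_mult \<iota> m (f s)) xs w = tensor_mult \<iota> m (foldr (\<lambda>s. tensor_mult \<iota> m (f s)) xs (pure_tensor 1 H1)) w"
    for xs w
    by (induction xs) (simp_all add: tensor_mult_one_left tensor_mult_assoc)
  from this[of "letters v" "word_eval \<iota> m f w"] show ?thesis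
    by (simp add: word_eval_def plus_fmon_def)
qed

lemma word_eval_single: "word_eval \<iota> m f (FMon [s]) = f s"
  by (simp add: word_eval_def tensor_mult_one_right)

sublocale eval: monoid_algebra_eval "\<lambda>c u r. \<iota> c * u r" "tensor_mult \<iota> m" "word_eval \<iota> m f" for f
  by standard (simp_all add: fun_eq_iff \<iota>_add distrib_left distrib_right word_eval_add
      tensor_mult_add_left tensor_mult_add_right tensor_mult_smult)

lemma tensor_alg_simps:
  "carrier (tensor_alg \<iota> m) = UNIV"
  "u \<otimes>\<^bsub>tensor_alg \<iota> m\<^esub> v = tensor_mult \<iota> m u v"
  "\<one>\<^bsub>tensor_alg \<iota> m\<^esub> = pure_tensor 1 H1"
  "\<zero>\<^bsub>tensor_alg \<iota> m\<^esub> = 0"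
  "u \<oplus>\<^bsub>tensor_alg \<iota> m\<^esub> v = u + v"
  "c \<odot>\<^bsub>tensor_alg \<iota> m\<^esub> u = (\<lambda>r. \<iota> c * u r)"
  by (simp_all add: tensor_alg_def tensor_mult_def[abs_def] zero_fun_def plus_fun_def)

lemma abelian_group_tensor_alg: "abelian_group (tensor_alg \<iota> m)"
proof (rule abelian_groupI; unfold tensor_alg_simps)
  show "\<exists>y\<in>UNIV. y + x = 0" for x :: "sw \<Rightarrow> 'r"
    by (intro bexI[of _ "- x"]) simp_all
qed (simp_all add: add.assoc add.commute)

lemma finsum_tensor_alg: "finite A \<Longrightarrow> finsum (tensor_alg \<iota> m) f A = sum f A"
proof (induction A rule: finite_induct)
  case empty
  interpret abelian_group "tensor_alg \<iota> m" by (rule abelian_group_tensor_alg)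
  show ?case by (simp add: tensor_alg_simps)
next
  case (insert x F)
  interpret abelian_group "tensor_alg \<iota> m" by (rule abelian_group_tensor_alg)
  have "finsum (tensor_alg \<iota> m) f (insert x F) = f x \<oplus>\<^bsub>tensor_alg \<iota> m\<^esub> finsum (tensor_alg \<iota> m) f F"
    by (rule finsum_insert) (use insert.hyps in \<open>simp_all add: tensor_alg_simps\<close>)
  then show ?case
    using insert by (simp add: tensor_alg_simps)
qed

lemma free_lift_eq: "free_lift (tensor_alg \<iota> m) f = lin_eval (\<lambda>c u r. \<iota> c * u r) (word_eval \<iota> m f)"
  by (rule ext) (simp add: free_lift_def lin_eval_def finsum_tensor_alg word_eval_def tensor_alg_simps)

lemma free_lift_add:
  "free_lift (tensor_alg \<iota> m) f (P + Q) = free_lift (tensor_alg \<iota> m) f P + free_lift (tensor_alg \<iota> m) f Q"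
  by (simp add: free_lift_eq eval.lin_eval_add)

lemma free_lift_mult:
  "free_lift (tensor_alg \<iota> m) f (P * Q) =
   tensor_mult \<iota> m (free_lift (tensor_alg \<iota> m) f P) (free_lift (tensor_alg \<iota> m) f Q)"
  by (simp add: free_lift_eq eval.lin_eval_mult)

lemma free_lift_pconst: "free_lift (tensor_alg \<iota> m) f (pconst c) = pure_tensor (\<iota> c) H1"
  by (simp add: free_lift_eq eval.lin_eval_single pconst_def word_eval_zero pure_tensor_def fun_eq_iff)

lemma free_lift_smult: "free_lift (tensor_alg \<iota> m) f (pconst c * P) = (\<lambda>r. \<iota> c * free_lift (tensor_alg \<iota> m) f P r)"
proof -
  have "pure_tensor (\<iota> c) H1 = (\<lambda>r. \<iota> c * pure_tensor 1 H1 r)"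
    by (simp add: pure_tensor_def fun_eq_iff)
  then show ?thesis
    using tensor_mult_smult[of c "pure_tensor 1 H1" 1 "free_lift (tensor_alg \<iota> m) f P"]
    by (simp add: free_lift_mult free_lift_pconst tensor_mult_one_left \<iota>_one)
qed

lemma free_lift_zero: "free_lift (tensor_alg \<iota> m) f 0 = 0"
  by (simp add: free_lift_eq eval.lin_eval_zero)

lemma free_lift_one: "free_lift (tensor_alg \<iota> m) f 1 = pure_tensor 1 H1"
  using free_lift_pconst[of f 1] by (simp add: pconst_def \<iota>_one)

lemma free_lift_sum: "free_lift (tensor_alg \<iota> m) f (sum P A) = (\<Sum>x\<in>A. free_lift (tensor_alg \<iota> m) f (P x))"
  by (induction A rule: infinite_finite_induct) (simp_all add: free_lift_zero free_lift_add)

lemma free_lift_Xvar: "free_lift (tensor_alg \<iota> m) f (Xvar s) = f s"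
  by (simp add: free_lift_eq eval.lin_eval_single Xvar_def word_eval_single \<iota>_one)

end

text \<open>Reduces statements about morphisms on T(X_H) to scalars and the four letters: a word is
  a product of letters, and a monomial is a scalar times a word.\<close>

lemma TX_induct [case_names const gen add mult]:
  assumes const: "\<And>c. R (pconst c)"
    and gen: "\<And>s. R (Xvar s)"
    and add: "\<And>P Q. R P \<Longrightarrow> R Q \<Longrightarrow> R (P + Q)"
    and mult: "\<And>P Q. R P \<Longrightarrow> R Q \<Longrightarrow> R (P * Q)"
  shows "R (P :: 'k::field TX)"
proof (induction P rule: poly_mapping_single_induct)
  case zero
  show ?case using const[of 0] by (simp add: pconst_def)
next
  case (single w c)
  have word: "R (Poly_Mapping.single (FMon xs) 1)" for xs
  proof (induction xs)
    case Nil
    show ?case using const[of 1] by (simp add: pconst_def zero_fmon_def)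
  next
    case (Cons x xs)
    have "Poly_Mapping.single (FMon (x # xs)) 1 = (Xvar x * Poly_Mapping.single (FMon xs) 1 :: 'k TX)"
      by (simp add: Xvar_def mult_single plus_fmon_def)
    with mult[OF gen Cons] show ?case by simp
  qed
  have "Poly_Mapping.single w c = pconst c * Poly_Mapping.single (FMon (letters w)) 1"
    by (simp add: pconst_def mult_single)
  with mult[OF const[of c] word[of "letters w"]] show ?case by simp
qed (fact add)

section \<open>Structure maps of the coefficient rings and the embedding of S(t_H) into K_H\<close>

interpretation pconst: structure_hom "pconst :: 'k::comm_ring_1 \<Rightarrow> 'm::monoid_add \<Rightarrow>\<^sub>0 'k"
proof
  fix c :: 'k and u :: "'m \<Rightarrow>\<^sub>0 'k"
  show "pconst c * u = u * pconst c"
    by (induction u rule: poly_mapping_single_induct)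
      (simp_all add: pconst_def mult_single mult.commute distrib_left distrib_right)
qed (simp_all add: pconst_def single_add mult_single)

interpretation scalar: structure_hom "\<lambda>k. k :: 'k::comm_ring_1"
  by standard (simp_all add: mult.commute)

lemma St_to_KH_add: "St_to_KH (p + q) = St_to_KH p + St_to_KH q"
  unfolding St_to_KH_def by (subst add_fract) (simp_all only: mult_1_right one_neq_zero not_False_eq_True)

lemma St_to_KH_mult: "St_to_KH (p * q) = St_to_KH p * St_to_KH q"
  unfolding St_to_KH_def by (subst mult_fract) (simp_all only: mult_1_right)

lemma St_to_KH_one [simp]: "St_to_KH 1 = 1"
  unfolding St_to_KH_def by (rule One_fract_def[symmetric])

lemma St_to_KH_zero [simp]: "St_to_KH 0 = 0"
  unfolding St_to_KH_def by (rule Zero_fract_def[symmetric])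

lemma St_to_KH_eq_iff: "St_to_KH p = St_to_KH q \<longleftrightarrow> p = q"
  unfolding St_to_KH_def by (subst eq_fract(1)) (simp_all only: mult_1_right one_neq_zero not_False_eq_True)

interpretation KH: structure_hom "KH_const :: 'k::field \<Rightarrow> 'k KH"
proof
  show "KH_const 1 = (1 :: 'k KH)"
    unfolding KH_const_def pconst.\<iota>_one by (rule St_to_KH_one)
  fix c d :: 'k and u :: "'k KH"
  show "KH_const (c + d) = KH_const c + KH_const d"
    unfolding KH_const_def pconst.\<iota>_add by (rule St_to_KH_add)
  show "KH_const (c * d) = KH_const c * KH_const d"
    unfolding KH_const_def pconst.\<iota>_mult by (rule St_to_KH_mult)
  show "KH_const c * u = u * KH_const c"
    by (rule mult.commute)
qed

section \<open>The twisted algebra and its comodule algebra morphisms\<close>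

lemma twisted_mult_values:
  "twisted_mult a b c H1 h = pure_tensor 1 h"
  "twisted_mult a b c h H1 = pure_tensor 1 h"
  "twisted_mult a b c Hx Hx = pure_tensor a H1"
  "twisted_mult a b c Hx Hy = pure_tensor 1 Hz"
  "twisted_mult a b c Hx Hz = pure_tensor a Hy"
  "twisted_mult a b c Hy Hx = (\<lambda>r. pure_tensor b H1 r - pure_tensor 1 Hz r)"
  "twisted_mult a b c Hy Hy = pure_tensor c H1"
  "twisted_mult a b c Hy Hz = (\<lambda>r. pure_tensor b Hy r - pure_tensor c Hx r)"
  "twisted_mult a b c Hz Hx = (\<lambda>r. pure_tensor b Hx r - pure_tensor a Hy r)"
  "twisted_mult a b c Hz Hy = pure_tensor c Hx"
  "twisted_mult a b c Hz Hz = (\<lambda>r. pure_tensor b Hz r - pure_tensor (a * c) H1 r)"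
  by (rule ext, rename_tac r, case_tac r; cases h; simp add: twisted_mult_def pure_tensor_def)+

lemma tensor_algebra_twisted: "structure_hom \<iota> \<Longrightarrow> tensor_algebra \<iota> (twisted_mult a b c)"
  by (intro tensor_algebra.intro tensor_algebra_axioms.intro twisted_mult_assoc)
    (simp_all add: twisted_mult_values(1,2) pure_tensor_def)

interpretation TX_H: tensor_algebra "pconst :: 'k::field \<Rightarrow> 'k TX" sw_mult
proof
  show "sw_mult H1 h r = (if r = h then 1 else 0)" "sw_mult h H1 r = (if r = h then 1 else 0)" for h r
    by (cases h; cases r; simp add: pure_tensor_def)+
qed (rule sw_mult_assoc)

interpretation twisted: tensor_algebra "\<lambda>k. k" "twisted_mult a b c" for a b c :: "'k::field"
  by (rule tensor_algebra_twisted) unfold_locales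

interpretation St_twisted: tensor_algebra "pconst :: 'k \<Rightarrow> 'k St" "twisted_mult a b c" for a b c :: "'k::field"
  by (rule tensor_algebra_twisted) unfold_locales

interpretation KH_twisted: tensor_algebra KH_const "twisted_mult a b c" for a b c :: "'k::field"
  by (rule tensor_algebra_twisted) unfold_locales

text \<open>Uniqueness in the universal property of the free algebra. It is applied with
  \<open>h\<close> the inclusion of S(t_H) in K_H and with \<open>h\<close> the evaluation at a
  point of k^4.\<close>

lemma free_lift_comp:
  assumes "tensor_algebra \<iota> m" "tensor_algebra \<iota>' m"
    and h_add: "\<And>u v. h (u + v) = h u + h v"
    and h_mult: "\<And>u v. h (u * v) = h u * h v"
    and h_\<iota>: "\<And>c. h (\<iota> c) = \<iota>' c"
    and f': "\<And>s r. f' s r = h (f s r)"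
  shows "free_lift (tensor_alg \<iota>' m) f' P r = h (free_lift (tensor_alg \<iota> m) f P r)"
proof -
  interpret A: tensor_algebra \<iota> m by fact
  interpret A': tensor_algebra \<iota>' m by fact
  have h_zero: "h 0 = 0"
    using h_add[of 0 0] by simp
  have h_sum: "h (\<Sum>s\<in>A. u s) = (\<Sum>s\<in>A. h (u s))" for u :: "sw \<Rightarrow> _" and A
    by (induction A rule: infinite_finite_induct) (simp_all add: h_zero h_add)
  show ?thesis
  proof (induction P arbitrary: r rule: TX_induct)
    case (const c)
    show ?case
      by (simp add: A.free_lift_pconst A'.free_lift_pconst pure_tensor_def h_zero h_\<iota>)
  next
    case (gen s)
    show ?case
      by (simp add: A.free_lift_Xvar A'.free_lift_Xvar f')
  next
    case (add P Q)
    then show ?case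
      by (simp add: A.free_lift_add A'.free_lift_add h_add)
  next
    case (mult P Q)
    then show ?case
      by (simp add: A.free_lift_mult A'.free_lift_mult tensor_mult_def h_sum h_mult h_\<iota>)
  qed
qed

lemma twisted_tensor_mult:
  fixes u v :: "sw \<Rightarrow> 'r::comm_ring_1" and a b c :: "'k::field"
  assumes "structure_hom \<iota>"
  defines "w \<equiv> tensor_mult \<iota> (twisted_mult a b c) u v"
  shows "w H1 = u H1 * v H1 + \<iota> a * (u Hx * v Hx) + \<iota> b * (u Hy * v Hx) + \<iota> c * (u Hy * v Hy)
      - \<iota> a * \<iota> c * (u Hz * v Hz)"
    and "w Hx = u H1 * v Hx + u Hx * v H1 - \<iota> c * (u Hy * v Hz) + \<iota> b * (u Hz * v Hx) + \<iota> c * (u Hz * v Hy)"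
    and "w Hy = u H1 * v Hy + u Hy * v H1 + \<iota> a * (u Hx * v Hz) + \<iota> b * (u Hy * v Hz) - \<iota> a * (u Hz * v Hx)"
    and "w Hz = u H1 * v Hz + u Hz * v H1 + u Hx * v Hy - u Hy * v Hx + \<iota> b * (u Hz * v Hz)"
proof -
  interpret structure_hom \<iota> by fact
  show "w H1 = u H1 * v H1 + \<iota> a * (u Hx * v Hx) + \<iota> b * (u Hy * v Hx) + \<iota> c * (u Hy * v Hy)
      - \<iota> a * \<iota> c * (u Hz * v Hz)"
    "w Hx = u H1 * v Hx + u Hx * v H1 - \<iota> c * (u Hy * v Hz) + \<iota> b * (u Hz * v Hx) + \<iota> c * (u Hz * v Hy)"
    "w Hy = u H1 * v Hy + u Hy * v H1 + \<iota> a * (u Hx * v Hz) + \<iota> b * (u Hy * v Hz) - \<iota> a * (u Hz * v Hx)"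
    "w Hz = u H1 * v Hz + u Hz * v H1 + u Hx * v Hy - u Hy * v Hx + \<iota> b * (u Hz * v Hz)"
    by (simp_all add: w_def tensor_mult_def sum_sw twisted_mult_values pure_tensor_def \<iota>_zero \<iota>_one \<iota>_minus \<iota>_diff \<iota>_mult algebra_simps)
qed

lemma comult_values:
  "comult u H1 p = (case p of H1 \<Rightarrow> u H1 | Hz \<Rightarrow> u Hz | _ \<Rightarrow> 0)"
  "comult u Hx p = (case p of Hx \<Rightarrow> u Hx | Hy \<Rightarrow> u Hy | _ \<Rightarrow> 0)"
  "comult u Hy p = (case p of H1 \<Rightarrow> u Hy | _ \<Rightarrow> 0)"
  "comult u Hz p = (case p of Hx \<Rightarrow> u Hz | _ \<Rightarrow> 0)"
  by (cases p; simp add: comult_def sum_sw)+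

text \<open>The cocycle acts on the left tensor factor only: the right factors \<open>g\<close>,
  \<open>h\<close> multiply by \<open>sw_mult\<close>, the left ones by the twisted product. Hence
  the coaction is multiplicative.\<close>

lemma comult_twisted_mult:
  fixes u v :: "sw \<Rightarrow> 'k::field"
  shows "comult (tensor_mult (\<lambda>k. k) (twisted_mult a b c) u v) q p =
    (\<Sum>g\<in>UNIV. \<Sum>h\<in>UNIV. sw_mult g h q * tensor_mult (\<lambda>k. k) (twisted_mult a b c) (comult u g) (comult v h) p)"
  by (cases q; cases p)
    (simp_all add: sum_sw comult_values twisted_tensor_mult[OF scalar.structure_hom_axioms] pure_tensor_def)

text \<open>The counit axiom for the left factor, since \<open>H1\<close> and \<open>Hx\<close> are
  the basis elements of counit 1.\<close>

lemma comult_counit: "comult u q H1 + comult u q Hx = (u q :: 'k::comm_monoid_add)"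
  by (cases q) (simp_all add: comult_values)

definition spec_hom :: "'k::field \<Rightarrow> 'k \<Rightarrow> 'k \<Rightarrow> (sw \<Rightarrow> 'k) \<Rightarrow> 'k TX \<Rightarrow> sw \<Rightarrow> 'k"
  where "spec_hom a b c l = free_lift (twisted_alg a b c) (cogen l)"

lemma spec_hom_coaction:
  "comult (spec_hom a b c l P) = (\<lambda>q. spec_hom a b c l (TX_coaction P q))"
proof (induction P rule: TX_induct)
  case (const k)
  show ?case
  proof (intro ext)
    fix q p
    show "comult (spec_hom a b c l (pconst k)) q p = spec_hom a b c l (TX_coaction (pconst k) q) p"
      by (cases q; cases p) (simp_all add: spec_hom_def twisted_alg_def TX_coaction_def
        twisted.free_lift_pconst TX_H.free_lift_pconst comult_values pure_tensor_def twisted.free_lift_zero)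
  qed
next
  case (gen s)
  show ?case
  proof (intro ext)
    fix q p
    show "comult (spec_hom a b c l (Xvar s)) q p = spec_hom a b c l (TX_coaction (Xvar s) q) p"
      by (cases s; cases q; cases p) (simp_all add: spec_hom_def twisted_alg_def TX_coaction_def
        twisted.free_lift_Xvar TX_H.free_lift_Xvar comult_values cogen_def pure_tensor_def twisted.free_lift_zero)
  qed
next
  case (add P Q)
  have comult_add: "comult (u + v) q p = comult u q p + comult v q p" for u v :: "sw \<Rightarrow> 'a" and q p
    by (simp add: comult_def sum_sw)
  have hom: "spec_hom a b c l (P + Q) = spec_hom a b c l P + spec_hom a b c l Q" for P Q
    by (simp add: spec_hom_def twisted_alg_def twisted.free_lift_add)
  have "TX_coaction (P + Q) q = TX_coaction P q + TX_coaction Q q" for q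
    by (simp add: TX_coaction_def TX_H.free_lift_add)
  then show ?case
    by (intro ext) (simp only: hom comult_add add, simp only: plus_fun_apply)
next
  case (mult P Q)
  let ?f = "spec_hom a b c l"
  show ?case
  proof (intro ext)
    fix q p
    have "?f (TX_coaction (P * Q) q) = ?f (\<Sum>g\<in>UNIV. \<Sum>h\<in>UNIV. pconst (sw_mult g h q) * (TX_coaction P g * TX_coaction Q h))"
      by (simp add: TX_coaction_def TX_H.free_lift_mult tensor_mult_def)
    also have "\<dots> = (\<Sum>g\<in>UNIV. \<Sum>h\<in>UNIV. (\<lambda>r. sw_mult g h q *
        tensor_mult (\<lambda>k. k) (twisted_mult a b c) (?f (TX_coaction P g)) (?f (TX_coaction Q h)) r))"
      unfolding spec_hom_def twisted_alg_def twisted.free_lift_sum twisted.free_lift_smult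
      unfolding twisted.free_lift_mult ..
    finally have "?f (TX_coaction (P * Q) q) p = (\<Sum>g\<in>UNIV. \<Sum>h\<in>UNIV. (\<lambda>r. sw_mult g h q *
        tensor_mult (\<lambda>k. k) (twisted_mult a b c) (?f (TX_coaction P g)) (?f (TX_coaction Q h)) r)) p"
      by (rule fun_cong)
    also have "\<dots> = comult (tensor_mult (\<lambda>k. k) (twisted_mult a b c) (?f P) (?f Q)) q p"
      by (simp add: comult_twisted_mult mult sum_sw)
    also have "\<dots> = comult (?f (P * Q)) q p"
      by (simp add: spec_hom_def twisted_alg_def twisted.free_lift_mult)
    finally show "comult (?f (P * Q)) q p = ?f (TX_coaction (P * Q) q) p"
      by (rule sym)
  qed
qed

lemma spec_hom_in_comodule_alg_homs: "spec_hom a b c l \<in> comodule_alg_homs a b c"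
proof -
  have smult: "spec_hom a b c l (pconst k * P) = (\<lambda>r. k * spec_hom a b c l P r)" for k P
    by (simp add: spec_hom_def twisted_alg_def twisted.free_lift_smult)
  have "spec_hom a b c l \<in> ring_hom TX_alg (twisted_alg a b c)"
    by (rule ring_hom_memI) (simp_all add: spec_hom_def twisted_alg_def twisted.tensor_alg_simps
      TX_alg_def type_alg_def twisted.free_lift_mult twisted.free_lift_add twisted.free_lift_one)
  then show ?thesis
    unfolding comodule_alg_homs_def alg_hom_def
    by (simp add: spec_hom_coaction smult)
      (simp add: TX_alg_def type_alg_def smult twisted_alg_def twisted.tensor_alg_simps)
qed

text \<open>H is cofree as a comodule over itself, so a comodule map into it is determined by its
  composite with the counit. The point \<open>l\<close> is that composite on the four
  letters.\<close>

lemma comodule_alg_hom_eq_spec_hom: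
  assumes f: "f \<in> comodule_alg_homs a b c"
  obtains l where "f = spec_hom a b c l"
proof
  define l where "l s = f (Xvar s) H1 + f (Xvar s) Hx" for s
  have hom: "f \<in> ring_hom TX_alg (twisted_alg a b c)"
    and smult: "f (pconst k * P) = (\<lambda>r. k * f P r)"
    and coaction: "comult (f P) = (\<lambda>q. f (TX_coaction P q))" for k P
    using f by (auto simp: comodule_alg_homs_def alg_hom_def TX_alg_def type_alg_def
        twisted_alg_def twisted.tensor_alg_simps)
  have add: "f (P + Q) = f P + f Q"
    and mult: "f (P * Q) = tensor_mult (\<lambda>k. k) (twisted_mult a b c) (f P) (f Q)"
    and one: "f 1 = pure_tensor 1 H1" for P Q
    using ring_hom_add[OF hom, of P Q] ring_hom_mult[OF hom, of P Q] ring_hom_one[OF hom]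
    by (simp_all add: TX_alg_def type_alg_def twisted_alg_def twisted.tensor_alg_simps)
  have const: "f (pconst k) = pure_tensor k H1" for k
    using smult[of k 1] by (simp add: one pure_tensor_def fun_eq_iff)
  have zero: "f 0 = 0"
    using add[of 0 0] by simp
  have gen: "f (Xvar s) = cogen l s" for s
  proof
    fix r
    \<comment> \<open>The counit axiom for \<open>f (Xvar s)\<close>; the comodule property then
      moves the coaction to the letter, where it is known.\<close>
    have "f (Xvar s) r = f (TX_coaction (Xvar s) r) H1 + f (TX_coaction (Xvar s) r) Hx"
      using comult_counit[of "f (Xvar s)" r] by (simp add: coaction)
    then show "f (Xvar s) r = cogen l s r"
      by (cases s; cases r) (simp_all add: TX_coaction_def TX_H.free_lift_Xvar cogen_def pure_tensor_def l_def zero)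
  qed
  show "f = spec_hom a b c l"
  proof
    fix P
    show "f P = spec_hom a b c l P"
      by (induction P rule: TX_induct) (simp_all add: spec_hom_def twisted_alg_def const gen add mult
        twisted.free_lift_pconst twisted.free_lift_Xvar twisted.free_lift_add twisted.free_lift_mult)
  qed
qed

section \<open>Vanishing on points of an infinite field\<close>

text \<open>A polynomial with infinitely many roots is zero. Several indices may share an exponent,
  so a coefficient is a sum over a fibre of \<open>d\<close>.\<close>

lemma power_sum_eq_zero:
  fixes g :: "'f \<Rightarrow> 'k::field"
  assumes "finite F" "infinite S" and zero: "\<And>x. x \<in> S \<Longrightarrow> (\<Sum>f\<in>F. g f * x ^ d f) = 0"
  shows "(\<Sum>f\<in>{f \<in> F. d f = i}. g f) = 0"
proof -
  define p where "p = (\<Sum>f\<in>F. monom (g f) (d f))"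
  have "S \<subseteq> {x. poly p x = 0}"
    using zero by (auto simp: p_def poly_sum poly_monom)
  then have "p = 0"
    using \<open>infinite S\<close> poly_roots_finite finite_subset by blast
  then have "coeff (\<Sum>f\<in>F. monom (g f) (d f)) i = 0"
    by (simp add: p_def)
  then have "(\<Sum>f\<in>F. if d f = i then g f else 0) = 0"
    by (simp add: coeff_sum)
  then show ?thesis
    using \<open>finite F\<close> by (simp add: sum.inter_filter)
qed

text \<open>The variables are removed one at a time, from w back to x, keeping only the terms with
  the exponent of \<open>f\<close>; \<open>inj\<close> leaves a single term at the end.\<close>

lemma monomial_sum_eq_zero:
  fixes g :: "'f \<Rightarrow> 'k::field"
  assumes F: "finite F" and S: "infinite S1" "infinite S2" "infinite S3" "infinite S4"
    and zero: "\<And>x y z w. x \<in> S1 \<Longrightarrow> y \<in> S2 \<Longrightarrow> z \<in> S3 \<Longrightarrow> w \<in> S4 \<Longrightarrow>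
      (\<Sum>f\<in>F. g f * x ^ d1 f * y ^ d2 f * z ^ d3 f * w ^ d4 f) = 0"
    and inj: "inj_on (\<lambda>f. (d1 f, d2 f, d3 f, d4 f)) F" and f: "f \<in> F"
  shows "g f = 0"
proof -
  define F1 where "F1 = {f' \<in> F. d4 f' = d4 f}"
  define F2 where "F2 = {f' \<in> F1. d3 f' = d3 f}"
  define F3 where "F3 = {f' \<in> F2. d2 f' = d2 f}"
  have fin: "finite F1" "finite F2" "finite F3"
    using F by (auto simp: F1_def F2_def F3_def)
  have 1: "(\<Sum>f\<in>F1. g f * x ^ d1 f * y ^ d2 f * z ^ d3 f) = 0" if "x \<in> S1" "y \<in> S2" "z \<in> S3" for x y z
    unfolding F1_def using F S(4) zero[OF that] by (rule power_sum_eq_zero)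
  have 2: "(\<Sum>f\<in>F2. g f * x ^ d1 f * y ^ d2 f) = 0" if "x \<in> S1" "y \<in> S2" for x y
    unfolding F2_def using fin(1) S(3) 1[OF that] by (rule power_sum_eq_zero)
  have 3: "(\<Sum>f\<in>F3. g f * x ^ d1 f) = 0" if "x \<in> S1" for x
    unfolding F3_def using fin(2) S(2) 2[OF that] by (rule power_sum_eq_zero)
  have "(\<Sum>f\<in>{f' \<in> F3. d1 f' = d1 f}. g f) = 0"
    using fin(3) S(1) 3 by (rule power_sum_eq_zero)
  moreover have "{f' \<in> F3. d1 f' = d1 f} = {f}"
    using inj f by (auto simp: F1_def F2_def F3_def inj_on_def)
  ultimately show ?thesis by simp
qed

section \<open>Evaluation of S(t_H) at points of k^4\<close>

definition point_eval :: "(sw \<Rightarrow> 'k::field) \<Rightarrow> 'k St \<Rightarrow> 'k"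
  where "point_eval l = lin_eval (*) (\<lambda>m. \<Prod>s\<in>UNIV. l s ^ Poly_Mapping.lookup m s)"

interpretation point: monoid_algebra_eval "(*)" "(*)" "\<lambda>m. \<Prod>s\<in>UNIV. l s ^ Poly_Mapping.lookup m s"
  for l :: "sw \<Rightarrow> 'k::field"
  by standard (simp_all add: distrib_left distrib_right lookup_add power_add prod.distrib)

lemma point_eval_add: "point_eval l (p + q) = point_eval l p + point_eval l q"
  unfolding point_eval_def by (rule point.lin_eval_add)

lemma point_eval_mult: "point_eval l (p * q) = point_eval l p * point_eval l q"
  unfolding point_eval_def by (rule point.lin_eval_mult)

lemma point_eval_zero: "point_eval l 0 = 0"
  unfolding point_eval_def by (rule point.lin_eval_zero)

lemma point_eval_pconst: "point_eval l (pconst c) = c"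
  unfolding point_eval_def pconst_def point.lin_eval_single by simp

lemma point_eval_one: "point_eval l 1 = 1"
  using point_eval_pconst[of l 1] unfolding pconst.\<iota>_one .

lemma point_eval_power: "point_eval l (p ^ n) = point_eval l p ^ n"
  by (induction n) (simp_all add: point_eval_one point_eval_mult)

lemma point_eval_sum: "point_eval l (sum f A) = (\<Sum>x\<in>A. point_eval l (f x))"
  by (induction A rule: infinite_finite_induct) (simp_all add: point_eval_zero point_eval_add)

lemma point_eval_tvar: "point_eval l (tvar s) = l s"
  unfolding point_eval_def tvar_def point.lin_eval_single
  by (cases s) (simp_all add: UNIV_sw lookup_single when_def)

lemma St_eqI_point_eval:
  fixes p :: "'k::field St"
  assumes k: "infinite (UNIV :: 'k set)" and zero: "\<And>l. point_eval l p = 0"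
  shows "p = 0"
proof (rule ccontr)
  assume "p \<noteq> 0"
  then obtain m where m: "m \<in> Poly_Mapping.keys p"
    by (metis all_not_in_conv keys_eq_empty)
  have "Poly_Mapping.lookup p m = 0"
  proof (rule monomial_sum_eq_zero[OF finite_keys k k k k _ _ m])
    fix x y z w :: 'k
    let ?l = "\<lambda>s. case s of H1 \<Rightarrow> x | Hx \<Rightarrow> y | Hy \<Rightarrow> z | Hz \<Rightarrow> w"
    show "(\<Sum>m\<in>Poly_Mapping.keys p. Poly_Mapping.lookup p m * x ^ Poly_Mapping.lookup m H1 *
        y ^ Poly_Mapping.lookup m Hx * z ^ Poly_Mapping.lookup m Hy * w ^ Poly_Mapping.lookup m Hz) = 0"
      using zero[of ?l] by (simp add: point_eval_def lin_eval_def UNIV_sw mult.assoc)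
  next
    show "inj_on (\<lambda>m. (Poly_Mapping.lookup m H1, Poly_Mapping.lookup m Hx, Poly_Mapping.lookup m Hy,
        Poly_Mapping.lookup m Hz)) (Poly_Mapping.keys p)"
    proof (rule inj_onI)
      fix m n :: "sw \<Rightarrow>\<^sub>0 nat"
      assume *: "(Poly_Mapping.lookup m H1, Poly_Mapping.lookup m Hx, Poly_Mapping.lookup m Hy, Poly_Mapping.lookup m Hz) =
        (Poly_Mapping.lookup n H1, Poly_Mapping.lookup n Hx, Poly_Mapping.lookup n Hy, Poly_Mapping.lookup n Hz)"
      show "m = n"
      proof (rule poly_mapping_eqI)
        fix s show "Poly_Mapping.lookup m s = Poly_Mapping.lookup n s"
          using * by (cases s) simp_all
      qed
    qed
  qed
  with m show False by (simp add: in_keys_iff)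
qed

section \<open>The morphism nu and the ideal of identities as its kernel\<close>

definition nu :: "'k::field \<Rightarrow> 'k \<Rightarrow> 'k \<Rightarrow> 'k TX \<Rightarrow> sw \<Rightarrow> 'k KH"
  where "nu a b c = free_lift (tensor_alg KH_const (twisted_mult a b c)) (cogen t_gen)"

lemma nu_eq_mu_free: "nu a b c P r = St_to_KH (mu_free a b c P r)"
  unfolding nu_def mu_free_def
proof (rule free_lift_comp[where h = St_to_KH])
  show "cogen t_gen s r = St_to_KH (cogen tvar s r)" for s r
    by (cases s; cases r) (simp_all add: cogen_def pure_tensor_def t_gen_def)
  show "St_to_KH (pconst k) = KH_const k" for k :: 'a
    by (simp only: KH_const_def)
qed (rule St_to_KH_add St_to_KH_mult St_twisted.tensor_algebra_axioms KH_twisted.tensor_algebra_axioms)+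

lemma spec_hom_eq_point_eval: "spec_hom a b c l P r = point_eval l (mu_free a b c P r)"
  unfolding spec_hom_def twisted_alg_def mu_free_def
proof (rule free_lift_comp[where h = "point_eval l"])
  show "cogen l s r = point_eval l (cogen tvar s r)" for s r
    by (cases s; cases r) (simp_all add: cogen_def pure_tensor_def point_eval_tvar point_eval_zero)
qed (rule point_eval_add point_eval_mult point_eval_pconst St_twisted.tensor_algebra_axioms
    twisted.tensor_algebra_axioms)+

lemma nu_eq_zero_iff: "nu a b c P = 0 \<longleftrightarrow> mu_free a b c P = 0"
proof -
  have "nu a b c P r = 0 \<longleftrightarrow> mu_free a b c P r = 0" for r
    unfolding nu_eq_mu_free using St_to_KH_eq_iff[of _ 0] by simp
  then show ?thesis by (simp add: fun_eq_iff)
qed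

lemma IH_eq:
  fixes a b c :: "'k::field"
  assumes "infinite (UNIV :: 'k set)"
  shows "IH a b c = {P. nu a b c P = 0}"
proof -
  have "P \<in> IH a b c \<longleftrightarrow> (\<forall>l. spec_hom a b c l P = 0)" for P
    unfolding IH_def zero_fun_def
    by (auto intro: spec_hom_in_comodule_alg_homs elim: comodule_alg_hom_eq_spec_hom)
  moreover have "(\<forall>l. spec_hom a b c l P = 0) \<longleftrightarrow> mu_free a b c P = 0" for P
    using St_eqI_point_eval[OF assms, of "mu_free a b c P _"]
    by (auto simp: fun_eq_iff spec_hom_eq_point_eval point_eval_zero)
  ultimately show ?thesis
    by (auto simp: nu_eq_zero_iff)
qed

section \<open>The universal comodule algebra and its center\<close>

lemma KH_const_eq_0_iff: "KH_const k = 0 \<longleftrightarrow> k = 0"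
proof
  assume "KH_const k = 0"
  then have "pconst k = (0 :: 'a St)"
    unfolding KH_const_def using St_to_KH_eq_iff[of "pconst k" 0] by simp
  then show "k = 0"
    unfolding pconst_def by (metis lookup_single_eq lookup_zero)
qed (simp add: KH.\<iota>_zero)

text \<open>The characteristic of a field is not 1, so it could divide 2 only by being 2.\<close>

lemma two_neq_zero:
  assumes "CHAR('k::field) \<noteq> 2"
  shows "(2 :: 'k) \<noteq> 0"
proof -
  have "CHAR('k) \<noteq> 1"
    using of_nat_CHAR[where ?'a = 'k] by auto
  then have "\<not> CHAR('k) dvd 2"
    using assms by (metis prime_nat_iff two_is_prime_nat)
  then show ?thesis
    using of_nat_eq_0_iff_char_dvd[where ?'a = 'k, of 2] by simp
qed

lemma nu_add: "nu a b c (P + Q) = nu a b c P + nu a b c Q"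
  by (simp add: nu_def KH_twisted.free_lift_add)

lemma nu_mult: "nu a b c (P * Q) = tensor_mult KH_const (twisted_mult a b c) (nu a b c P) (nu a b c Q)"
  by (simp add: nu_def KH_twisted.free_lift_mult)

lemma nu_smult: "nu a b c (pconst k * P) = (\<lambda>r. KH_const k * nu a b c P r)"
  by (simp add: nu_def KH_twisted.free_lift_smult)

lemma nu_one: "nu a b c 1 = pure_tensor 1 H1"
  by (simp add: nu_def KH_twisted.free_lift_one)

lemma nu_Xvar: "nu a b c (Xvar s) = cogen t_gen s"
  by (simp add: nu_def KH_twisted.free_lift_Xvar)

lemma nu_diff: "nu a b c (P - Q) = nu a b c P - nu a b c Q"
  using nu_add[of a b c "P - Q" Q] by (simp add: algebra_simps)

lemmas nu_mult_values =
  twisted_tensor_mult[OF KH.structure_hom_axioms, of a b c "nu a b c P" "nu a b c Q" for a b c P Q, folded nu_mult]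

lemma nu_Xvar_values:
  "nu a b c (Xvar H1) r = (case r of H1 \<Rightarrow> t_gen H1 | _ \<Rightarrow> 0)"
  "nu a b c (Xvar Hx) r = (case r of Hx \<Rightarrow> t_gen Hx | _ \<Rightarrow> 0)"
  "nu a b c (Xvar Hy) r = (case r of Hy \<Rightarrow> t_gen H1 | Hx \<Rightarrow> t_gen Hy | _ \<Rightarrow> 0)"
  "nu a b c (Xvar Hz) r = (case r of Hz \<Rightarrow> t_gen Hx | H1 \<Rightarrow> t_gen Hz | _ \<Rightarrow> 0)"
  by (cases r; simp add: nu_Xvar cogen_def pure_tensor_def)+

lemma KH_twisted_mult_pure_tensor:
  "tensor_mult KH_const (twisted_mult a b c) (pure_tensor q H1) u = (\<lambda>r. q * u r)"
  "tensor_mult KH_const (twisted_mult a b c) u (pure_tensor q H1) = (\<lambda>r. q * u r)"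
  by (rule ext, rename_tac r, case_tac r;
      simp add: twisted_tensor_mult[OF KH.structure_hom_axioms] pure_tensor_def mult.commute)+

text \<open>Commuting with X kills the coordinates at y and z, on which x acts by anticommutation up
  to terms in 1 and x; commuting with Y then kills the one at x. Each time the commutator is twice a
  coordinate times a nonzero factor.\<close>

lemma commute_imp_pure_tensor:
  fixes a b c :: "'k::field"
  assumes "CHAR('k) \<noteq> 2" "a \<noteq> 0"
    and X: "nu a b c (P * Xvar Hx) = nu a b c (Xvar Hx * P)"
    and Y: "nu a b c (P * Xvar Hy) = nu a b c (Xvar Hy * P)"
  shows "nu a b c P = pure_tensor (nu a b c P H1) H1"
proof -
  have two: "(2 :: 'k KH) \<noteq> 0"
    using two_neq_zero[OF assms(1)] KH_const_eq_0_iff[of "2 :: 'k"] by (simp add: KH.\<iota>_numeral)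
  have a0: "KH_const a \<noteq> 0"
    using \<open>a \<noteq> 0\<close> by (simp add: KH_const_eq_0_iff)
  let ?u = "nu a b c P"
  have "2 * (KH_const a * (?u Hz * t_gen Hx)) = 0" "2 * (?u Hy * t_gen Hx) = 0"
    using fun_cong[OF X, of Hy] fun_cong[OF X, of Hz]
    by (simp_all add: nu_mult_values nu_Xvar_values algebra_simps)
  then have yz: "?u Hy = 0" "?u Hz = 0"
    using two a0 by (simp_all add: t_gen_nonzero)
  have "2 * (?u Hx * t_gen H1) = 0"
    using fun_cong[OF Y, of Hz] by (simp add: nu_mult_values nu_Xvar_values yz algebra_simps)
  then have "?u Hx = 0"
    using two by (simp add: t_gen_nonzero)
  with yz show ?thesis
    unfolding fun_eq_iff by (intro allI, rename_tac r, case_tac r) (simp_all add: pure_tensor_def)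
qed

section \<open>Classes modulo the identities, and the center of the quotient\<close>

lemma TX_alg_simps:
  "carrier TX_alg = UNIV" "P \<otimes>\<^bsub>TX_alg\<^esub> Q = P * Q" "\<one>\<^bsub>TX_alg\<^esub> = 1"
  "\<zero>\<^bsub>TX_alg\<^esub> = 0" "P \<oplus>\<^bsub>TX_alg\<^esub> Q = P + Q" "k \<odot>\<^bsub>TX_alg\<^esub> P = pconst k * P"
  by (simp_all add: TX_alg_def type_alg_def)

locale sweedler_cocycle =
  fixes a b c :: "'k::field"
  assumes infinite_k: "infinite (UNIV :: 'k set)"
    and char_k: "CHAR('k) \<noteq> 2"
    and a_nonzero: "a \<noteq> 0"
begin

abbreviation "cls \<equiv> UH_class a b c"
abbreviation "\<nu> \<equiv> nu a b c"
abbreviation "U \<equiv> UH_alg a b c"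
abbreviation "Z \<equiv> ZH_alg a b c"

text \<open>Cosets of a kernel are fibres. From here on, equations between classes are decided by
  applying nu.\<close>

lemma UH_class_eq: "cls P = {Q. \<nu> Q = \<nu> P}"
proof -
  have "Q \<in> cls P \<longleftrightarrow> (\<exists>h. \<nu> h = 0 \<and> Q = h + P)" for Q
    by (simp add: UH_class_def IH_eq[OF infinite_k] a_r_coset_def' TX_alg_simps)
  also have "\<dots> Q \<longleftrightarrow> \<nu> Q = \<nu> P" for Q
  proof
    assume "\<nu> Q = \<nu> P"
    then have "\<nu> (Q - P) = 0" by (simp add: nu_diff)
    then show "\<exists>h. \<nu> h = 0 \<and> Q = h + P" by (intro exI[of _ "Q - P"]) simp
  qed (auto simp: nu_add)
  finally show ?thesis by auto
qed

lemma UH_class_eq_iff: "cls P = cls Q \<longleftrightarrow> \<nu> P = \<nu> Q"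
proof
  have "P \<in> cls P"
    by (simp add: UH_class_eq)
  moreover assume "cls P = cls Q"
  ultimately have "P \<in> cls Q"
    by simp
  then show "\<nu> P = \<nu> Q"
    by (simp add: UH_class_eq)
qed (simp add: UH_class_eq)

lemma UH_carrier: "carrier U = range cls"
  by (auto simp: UH_alg_def quot_alg_def ring.defs FactRing_def A_RCOSETS_def' TX_alg_simps UH_class_def)

lemma UH_mult: "cls P \<otimes>\<^bsub>U\<^esub> cls Q = cls (P * Q)"
proof -
  have "cls P \<otimes>\<^bsub>U\<^esub> cls Q = (\<Union>P'\<in>cls P. \<Union>Q'\<in>cls Q. cls (P' * Q'))"
    by (simp add: UH_alg_def quot_alg_def ring.defs FactRing_def rcoset_mult_def UH_class_def TX_alg_simps)
  then show ?thesis
    by (auto simp: UH_class_eq nu_mult)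
qed

lemma UH_one: "\<one>\<^bsub>U\<^esub> = cls 1"
  by (simp add: UH_alg_def quot_alg_def ring.defs FactRing_def UH_class_def TX_alg_simps)

lemma UH_add: "cls P \<oplus>\<^bsub>U\<^esub> cls Q = cls (P + Q)"
proof -
  have "cls P \<oplus>\<^bsub>U\<^esub> cls Q = (\<Union>P'\<in>cls P. \<Union>Q'\<in>cls Q. {P' + Q'})"
    by (simp add: UH_alg_def quot_alg_def ring.defs FactRing_def set_add_def' TX_alg_simps)
  \<comment> \<open>Cosets are added elementwise, so \<open>R\<close> has to be split: into
    \<open>P\<close> and \<open>R - P\<close>, the latter lying in the class of
    \<open>Q\<close>.\<close>
  moreover have "\<exists>P'. \<nu> P' = \<nu> P \<and> (\<exists>Q'. \<nu> Q' = \<nu> Q \<and> R = P' + Q')" if "\<nu> R = \<nu> P + \<nu> Q" for R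
    using that by (intro exI[of _ P] conjI refl exI[of _ "R - P"]) (simp_all add: nu_diff)
  ultimately show ?thesis
    by (auto simp: UH_class_eq nu_add)
qed

lemma UH_smult: "k \<odot>\<^bsub>U\<^esub> cls P = cls (pconst k * P)"
proof -
  have "k \<odot>\<^bsub>U\<^esub> cls P = (\<Union>P'\<in>cls P. cls (pconst k * P'))"
    by (simp add: UH_alg_def quot_alg_def ring.defs module.defs UH_class_def TX_alg_simps)
  then show ?thesis
    by (auto simp: UH_class_eq nu_smult)
qed

lemma mu_UH_class: "mu a b c (cls P) = mu_free a b c P"
proof -
  have "\<nu> Q = \<nu> P \<longleftrightarrow> mu_free a b c Q = mu_free a b c P" for Q
    by (simp add: fun_eq_iff nu_eq_mu_free St_to_KH_eq_iff)
  then have "mu_free a b c ` cls P = {mu_free a b c P}"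
    unfolding UH_class_eq by blast
  then show ?thesis by (simp add: mu_def)
qed

lemma ident_UH_class:
  assumes "\<nu> P = pure_tensor q H1"
  shows "ident a b c (cls P) = q"
proof -
  have "(\<lambda>r. St_to_KH (mu a b c (cls P) r)) = pure_tensor q H1"
    using assms by (simp add: mu_UH_class flip: nu_eq_mu_free)
  then show ?thesis
    unfolding ident_def by (auto simp: pure_tensor_def fun_eq_iff)
qed

lemma ZH_mem_iff: "cls P \<in> carrier Z \<longleftrightarrow> \<nu> P = pure_tensor (\<nu> P H1) H1"
proof
  assume "cls P \<in> carrier Z"
  then have "cls P \<otimes>\<^bsub>U\<^esub> cls Q = cls Q \<otimes>\<^bsub>U\<^esub> cls P" for Q
    unfolding ZH_alg_def center_alg_def by (simp add: UH_carrier)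
  then have "\<nu> (P * Q) = \<nu> (Q * P)" for Q
    unfolding UH_mult UH_class_eq_iff .
  then show "\<nu> P = pure_tensor (\<nu> P H1) H1"
    using char_k a_nonzero by (intro commute_imp_pure_tensor)
next
  assume *: "\<nu> P = pure_tensor (\<nu> P H1) H1"
  have "\<nu> (P * Q) = \<nu> (Q * P)" for Q
  proof -
    obtain q where "\<nu> P = pure_tensor q H1"
      using * by blast
    then show ?thesis
      by (simp only: nu_mult KH_twisted_mult_pure_tensor)
  qed
  then have "cls P \<otimes>\<^bsub>U\<^esub> cls Q = cls Q \<otimes>\<^bsub>U\<^esub> cls P" for Q
    unfolding UH_mult UH_class_eq_iff .
  then show "cls P \<in> carrier Z"
    unfolding ZH_alg_def center_alg_def by (auto simp: UH_carrier)
qed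

lemma ZH_cases:
  assumes "C \<in> carrier Z"
  obtains P q where "C = cls P" "\<nu> P = pure_tensor q H1" "ident a b c C = q"
proof -
  obtain P where P: "C = cls P"
    using assms by (auto simp: ZH_alg_def center_alg_def UH_carrier)
  then have "\<nu> P = pure_tensor (\<nu> P H1) H1"
    using assms ZH_mem_iff by blast
  with P show ?thesis
    using ident_UH_class that by blast
qed

lemma ZH_memI: "\<nu> P = pure_tensor q H1 \<Longrightarrow> cls P \<in> carrier Z"
  by (simp add: ZH_mem_iff pure_tensor_def)

lemma ZH_ops:
  "C \<otimes>\<^bsub>Z\<^esub> D = C \<otimes>\<^bsub>U\<^esub> D" "C \<oplus>\<^bsub>Z\<^esub> D = C \<oplus>\<^bsub>U\<^esub> D" "\<one>\<^bsub>Z\<^esub> = cls 1" "k \<odot>\<^bsub>Z\<^esub> C = k \<odot>\<^bsub>U\<^esub> C"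
  by (simp_all add: ZH_alg_def center_alg_def UH_one)

lemma ident_inj: "inj_on (ident a b c) (carrier Z)"
proof (rule inj_onI)
  fix C D
  assume C: "C \<in> carrier Z" and D: "D \<in> carrier Z" and eq: "ident a b c C = ident a b c D"
  obtain P q where P: "C = cls P" "\<nu> P = pure_tensor q H1" "ident a b c C = q"
    using C by (rule ZH_cases)
  obtain Q r where Q: "D = cls Q" "\<nu> Q = pure_tensor r H1" "ident a b c D = r"
    using D by (rule ZH_cases)
  show "C = D"
    unfolding P(1) Q(1) UH_class_eq_iff P(2) Q(2) using eq P(3) Q(3) by simp
qed

lemma ident_one: "\<one>\<^bsub>Z\<^esub> \<in> carrier Z" "ident a b c \<one>\<^bsub>Z\<^esub> = 1"
  by (simp_all add: ZH_ops ident_UH_class nu_one ZH_memI)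

lemma ident_ops:
  assumes C: "C \<in> carrier Z" and D: "D \<in> carrier Z"
  shows "C \<otimes>\<^bsub>Z\<^esub> D \<in> carrier Z" "ident a b c (C \<otimes>\<^bsub>Z\<^esub> D) = ident a b c C * ident a b c D"
    "C \<oplus>\<^bsub>Z\<^esub> D \<in> carrier Z" "ident a b c (C \<oplus>\<^bsub>Z\<^esub> D) = ident a b c C + ident a b c D"
proof -
  obtain P q where P: "C = cls P" "\<nu> P = pure_tensor q H1" "ident a b c C = q"
    using C by (rule ZH_cases)
  obtain Q r where Q: "D = cls Q" "\<nu> Q = pure_tensor r H1" "ident a b c D = r"
    using D by (rule ZH_cases)
  have "\<nu> (P * Q) = pure_tensor (q * r) H1"
    unfolding nu_mult P Q KH_twisted_mult_pure_tensor by (simp add: pure_tensor_def fun_eq_iff)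
  moreover have "\<nu> (P + Q) = pure_tensor (q + r) H1"
    unfolding nu_add P Q by (simp add: pure_tensor_def fun_eq_iff)
  ultimately show "C \<otimes>\<^bsub>Z\<^esub> D \<in> carrier Z" "ident a b c (C \<otimes>\<^bsub>Z\<^esub> D) = ident a b c C * ident a b c D"
    "C \<oplus>\<^bsub>Z\<^esub> D \<in> carrier Z" "ident a b c (C \<oplus>\<^bsub>Z\<^esub> D) = ident a b c C + ident a b c D"
    by (simp_all only: ZH_ops P Q UH_mult UH_add ident_UH_class ZH_memI)
qed

lemma ident_smult:
  assumes C: "C \<in> carrier Z"
  shows "k \<odot>\<^bsub>Z\<^esub> C \<in> carrier Z" "ident a b c (k \<odot>\<^bsub>Z\<^esub> C) = KH_const k * ident a b c C"
proof -
  obtain P q where P: "C = cls P" "\<nu> P = pure_tensor q H1" "ident a b c C = q"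
    using C by (rule ZH_cases)
  have "\<nu> (pconst k * P) = pure_tensor (KH_const k * q) H1"
    unfolding nu_smult P by (simp add: pure_tensor_def fun_eq_iff)
  then show "k \<odot>\<^bsub>Z\<^esub> C \<in> carrier Z" "ident a b c (k \<odot>\<^bsub>Z\<^esub> C) = KH_const k * ident a b c C"
    by (simp_all only: ZH_ops P UH_smult ident_UH_class ZH_memI)
qed

end

section \<open>Values of the generic cocycle\<close>

lemma KH_const_inverse: "KH_const (inverse k) = inverse (KH_const k)"
proof (cases "k = 0")
  case False
  then have "KH_const k * KH_const (inverse k) = 1"
    using KH.\<iota>_mult[of k "inverse k"] by (simp add: KH.\<iota>_one)
  then show ?thesis
    by (metis inverse_unique)
qed (simp add: KH.\<iota>_zero)

lemma KH_const_divide: "KH_const (k / l) = KH_const k / KH_const l"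
  by (simp add: divide_inverse KH.\<iota>_mult KH_const_inverse)

lemma cring_type_alg: "cring (type_alg (\<iota> :: 'k \<Rightarrow> 'r::comm_ring_1))"
proof (rule cringI)
  show "abelian_group (type_alg \<iota>)"
  proof (rule abelian_groupI)
    fix x
    show "\<exists>y\<in>carrier (type_alg \<iota>). y \<oplus>\<^bsub>type_alg \<iota>\<^esub> x = \<zero>\<^bsub>type_alg \<iota>\<^esub>"
      by (rule bexI[of _ "- x"]) (simp_all add: type_alg_def)
  qed (simp_all add: type_alg_def add_ac)
  show "comm_monoid (type_alg \<iota>)"
    by (rule comm_monoidI) (simp_all add: type_alg_def mult_ac)
qed (simp add: type_alg_def distrib_right)

lemma KH_alg_simps:
  "carrier KH_alg = UNIV" "u \<otimes>\<^bsub>KH_alg\<^esub> v = u * v" "\<one>\<^bsub>KH_alg\<^esub> = 1"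
  "\<zero>\<^bsub>KH_alg\<^esub> = 0" "u \<oplus>\<^bsub>KH_alg\<^esub> v = u + v" "k \<odot>\<^bsub>KH_alg\<^esub> u = KH_const k * u"
  by (simp_all add: KH_alg_def type_alg_def)

lemma a_inv_KH_alg: "\<ominus>\<^bsub>KH_alg\<^esub> u = - u"
proof -
  interpret cring KH_alg
    unfolding KH_alg_def by (rule cring_type_alg)
  show ?thesis
    by (rule minus_equality) (simp_all add: KH_alg_simps)
qed

text \<open>Zero, one and negatives come from scalars, leaving only sums and products to
  check.\<close>

lemma unital_subalgebra_KH_alg:
  "unital_subalgebra V KH_alg \<longleftrightarrow>
    (\<forall>k. KH_const k \<in> V) \<and> (\<forall>u\<in>V. \<forall>v\<in>V. u + v \<in> V) \<and> (\<forall>u\<in>V. \<forall>v\<in>V. u * v \<in> V)"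
proof -
  interpret cring KH_alg
    unfolding KH_alg_def by (rule cring_type_alg)
  show ?thesis
  proof safe
    assume V: "unital_subalgebra V KH_alg"
    then have subring: "subring V KH_alg"
      and smult: "v \<in> V \<Longrightarrow> k \<odot>\<^bsub>KH_alg\<^esub> v \<in> V" for k v
      by (simp_all add: unital_subalgebra_def)
    show "KH_const k \<in> V" for k
      using smult[OF subringE(3)[OF subring], of k] by (simp add: KH_alg_simps)
    show "u + v \<in> V" "u * v \<in> V" if "u \<in> V" "v \<in> V" for u v
      using subringE(7)[OF subring that] subringE(6)[OF subring that] by (simp_all add: KH_alg_simps)
  next
    assume V: "\<forall>k. KH_const k \<in> V" "\<forall>u\<in>V. \<forall>v\<in>V. u + v \<in> V" "\<forall>u\<in>V. \<forall>v\<in>V. u * v \<in> V"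
    have "KH_const 1 \<in> V" "KH_const (- 1) \<in> V"
      using V by blast+
    then have one: "1 \<in> V" "- 1 \<in> V"
      by (simp_all only: KH.\<iota>_minus KH.\<iota>_one)
    have minus: "- u \<in> V" if "u \<in> V" for u
    proof -
      have "- 1 * u \<in> V"
        using V(3) one(2) that by blast
      then show ?thesis by simp
    qed
    have "subring V KH_alg"
      by (rule subringI) (use V one minus in \<open>simp_all add: KH_alg_simps a_inv_KH_alg\<close>)
    then show "unital_subalgebra V KH_alg"
      using V by (simp add: unital_subalgebra_def KH_alg_simps)
  qed
qed

lemma unital_subalgebra_alg_gen_KH_alg: "unital_subalgebra (alg_gen KH_alg G) KH_alg"
  unfolding alg_gen_def by (rule hull_in) (auto simp: unital_subalgebra_KH_alg)

lemma
  shows alg_gen_const: "KH_const k \<in> alg_gen KH_alg G"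
    and alg_gen_add: "u \<in> alg_gen KH_alg G \<Longrightarrow> v \<in> alg_gen KH_alg G \<Longrightarrow> u + v \<in> alg_gen KH_alg G"
    and alg_gen_mult: "u \<in> alg_gen KH_alg G \<Longrightarrow> v \<in> alg_gen KH_alg G \<Longrightarrow> u * v \<in> alg_gen KH_alg G"
  using unital_subalgebra_alg_gen_KH_alg[of G] by (simp_all add: unital_subalgebra_KH_alg)

lemma alg_gen_zero: "0 \<in> alg_gen KH_alg G"
  and alg_gen_one: "1 \<in> alg_gen KH_alg G"
  using alg_gen_const[of 0 G] alg_gen_const[of 1 G] by (simp_all add: KH.\<iota>_zero KH.\<iota>_one)

lemma alg_gen_uminus: "u \<in> alg_gen KH_alg G \<Longrightarrow> - u \<in> alg_gen KH_alg G"
  using alg_gen_mult[OF alg_gen_const[of "- 1"], of u G] by (simp add: KH.\<iota>_minus KH.\<iota>_one)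

lemma alg_gen_diff: "u \<in> alg_gen KH_alg G \<Longrightarrow> v \<in> alg_gen KH_alg G \<Longrightarrow> u - v \<in> alg_gen KH_alg G"
  using alg_gen_add[of u G "- v"] alg_gen_uminus[of v G] by simp

lemma alg_gen_power: "u \<in> alg_gen KH_alg G \<Longrightarrow> u ^ n \<in> alg_gen KH_alg G"
  by (induction n) (simp_all add: alg_gen_one alg_gen_mult)

lemma alg_gen_sum: "(\<And>x. x \<in> A \<Longrightarrow> f x \<in> alg_gen KH_alg G) \<Longrightarrow> sum f A \<in> alg_gen KH_alg G"
  by (induction A rule: infinite_finite_induct) (simp_all add: alg_gen_zero alg_gen_add)

lemma alg_gen_incl: "u \<in> G \<Longrightarrow> u \<in> alg_gen KH_alg G"
  unfolding alg_gen_def by (rule hull_inc)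

lemma alg_gen_minimal:
  assumes "G \<subseteq> alg_gen KH_alg G'"
  shows "alg_gen KH_alg G \<subseteq> alg_gen KH_alg G'"
  using assms unital_subalgebra_alg_gen_KH_alg[of G'] unfolding alg_gen_def by (rule hull_minimal)

lemmas alg_gen_intros = alg_gen_const alg_gen_add alg_gen_mult alg_gen_zero alg_gen_one
  alg_gen_uminus alg_gen_diff alg_gen_power

section \<open>Tables of the inverse cocycle, of sigma and of its inverse\<close>

lemma alpha_inv_values:
  fixes a b c :: "'k::field"
  assumes "a \<noteq> 0"
  shows "alpha_inv a b c = (\<lambda>g h. case (g, h) of (Hx, Hx) \<Rightarrow> 1 / a | (Hy, Hx) \<Rightarrow> - b / a | (Hz, Hx) \<Rightarrow> - b / a
      | (Hy, Hy) \<Rightarrow> - c / a | (Hy, Hz) \<Rightarrow> c | (Hz, Hy) \<Rightarrow> - c | (Hz, Hz) \<Rightarrow> c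
      | (Hx, Hy) \<Rightarrow> 0 | (Hx, Hz) \<Rightarrow> 0 | _ \<Rightarrow> counit g * counit h)" (is "_ = ?f")
proof (rule is_conv_inverse2_unique[OF is_conv_inverse2_alpha_inv[OF assms]])
  show "is_conv_inverse2 (alpha a b c) ?f"
    unfolding is_conv_inverse2_def
  proof (intro allI)
    fix g h
    show "conv2 (alpha a b c) ?f g h = counit g * counit h \<and> conv2 ?f (alpha a b c) g h = counit g * counit h"
      using assms by (cases g; cases h) (simp_all add: conv2_def field_simps)
  qed
qed

lemma lin_ext_pure_tensor: "lin_ext f (pure_tensor k g) = KH_const k * f g"
  by (cases g) (simp_all add: lin_ext_def sum_sw pure_tensor_def KH.\<iota>_zero)

lemma lin_ext_zero: "lin_ext f (\<lambda>_. 0) = 0"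
  by (simp add: lin_ext_def KH.\<iota>_zero)

lemma bilin_ext_pure_tensor: "bilin_ext f (pure_tensor 1 g) (pure_tensor 1 h) = f g h"
  by (cases g; cases h) (simp_all add: bilin_ext_def sum_sw pure_tensor_def KH.\<iota>_zero KH.\<iota>_one)

context sweedler_cocycle
begin

text \<open>These four are the images of X^2, Y^2, T, U under mu, as \<open>nu_generators\<close>
  confirms; the image of E is \<open>t_gen H1\<close>.\<close>

definition gen_X2 :: "'k KH" where "gen_X2 = KH_const a * t_gen Hx ^ 2"
definition gen_Y2 :: "'k KH" where
  "gen_Y2 = KH_const a * t_gen Hy ^ 2 + KH_const b * t_gen H1 * t_gen Hy + KH_const c * t_gen H1 ^ 2"
definition gen_T :: "'k KH" where "gen_T = t_gen Hx * (2 * KH_const a * t_gen Hy + KH_const b * t_gen H1)"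
definition gen_U :: "'k KH" where "gen_U = gen_X2 * (2 * t_gen Hz + KH_const b * t_gen Hx)"

text \<open>The common target of both claims in (a): \<open>BH_eq_BB\<close> and
  \<open>BB_eq_fractions\<close> compare it with the two algebras.\<close>

definition BB :: "'k KH set" where
  "BB = alg_gen KH_alg {t_gen H1, inverse (t_gen H1), gen_X2, inverse gen_X2, gen_Y2, gen_T, gen_U}"

lemma KH_a: "KH_const a \<noteq> 0"
  using a_nonzero by (simp add: KH_const_eq_0_iff)

lemma KH_two: "(2 :: 'k KH) \<noteq> 0"
  using two_neq_zero[OF char_k] KH_const_eq_0_iff[of "2 :: 'k"] by (simp add: KH.\<iota>_numeral)

lemma KH_four: "(4 :: 'k KH) \<noteq> 0"
proof -
  have "(4 :: 'k KH) = 2 * 2" by simp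
  then show ?thesis using KH_two by (metis mult_eq_0_iff)
qed

lemma gen_X2_nonzero: "gen_X2 \<noteq> 0"
  by (simp add: gen_X2_def KH_a t_gen_nonzero)

lemmas BB_intros = alg_gen_intros[where G = "{t_gen H1, inverse (t_gen H1), gen_X2, inverse gen_X2, gen_Y2, gen_T, gen_U}",
    folded BB_def]

lemma BB_gens:
  "t_gen H1 \<in> BB" "inverse (t_gen H1) \<in> BB" "gen_X2 \<in> BB" "inverse gen_X2 \<in> BB"
  "gen_Y2 \<in> BB" "gen_T \<in> BB" "gen_U \<in> BB"
  unfolding BB_def by (simp_all add: alg_gen_incl)

text \<open>\<open>P\<close> is t_x s / t_1 and \<open>W\<close> is w. \<open>Q\<close> is (t_z^2 +
  b t_x t_z + a c t_x^2) / t_1 after completing the square in t_z; this rewrites sigma(z,z) through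
  w^2 and X^2, hence through the generators.\<close>

lemma sigma_values:
  defines "P \<equiv> gen_T * inverse (t_gen H1)" and "W \<equiv> gen_U * inverse gen_X2"
  defines "Q \<equiv> KH_const (1 / 4) * (W ^ 2 - KH_const ((b ^ 2 - 4 * a * c) / a) * gen_X2) * inverse (t_gen H1)"
  shows "sigma a b c H1 h = counit h * t_gen H1"
    "sigma a b c h H1 = counit h * t_gen H1"
    "sigma a b c Hx Hx = gen_X2 * inverse (t_gen H1)"
    "sigma a b c Hx Hy = KH_const (1 / 2) * (P - W)"
    "sigma a b c Hx Hz = - (KH_const (1 / 2) * (P - W))"
    "sigma a b c Hy Hx = KH_const (1 / 2) * (P + W)"
    "sigma a b c Hz Hx = KH_const (1 / 2) * (P + W)"
    "sigma a b c Hy Hy = gen_Y2 * inverse (t_gen H1)"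
    "sigma a b c Hy Hz = - (gen_Y2 * inverse (t_gen H1))"
    "sigma a b c Hz Hy = gen_Y2 * inverse (t_gen H1)"
    "sigma a b c Hz Hz = - Q"
proof -
  note simps = sigma_def lin_ext_pure_tensor lin_ext_zero t_inv_eqs KH.\<iota>_zero KH.\<iota>_one KH.\<iota>_minus KH.\<iota>_mult
    gen_X2_def gen_Y2_def P_def W_def gen_T_def gen_U_def KH_const_divide KH.\<iota>_numeral t_gen_nonzero KH_a KH_two KH_four
  have four: "4 = (2::'k KH) * 2" by simp
  show "sigma a b c H1 h = counit h * t_gen H1" "sigma a b c h H1 = counit h * t_gen H1"
    by (cases h; simp add: simps field_simps)+
  show "sigma a b c Hx Hx = gen_X2 * inverse (t_gen H1)"
    "sigma a b c Hx Hy = KH_const (1 / 2) * (P - W)"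
    "sigma a b c Hx Hz = - (KH_const (1 / 2) * (P - W))"
    "sigma a b c Hy Hx = KH_const (1 / 2) * (P + W)"
    "sigma a b c Hz Hx = KH_const (1 / 2) * (P + W)"
    "sigma a b c Hy Hy = gen_Y2 * inverse (t_gen H1)"
    "sigma a b c Hy Hz = - (gen_Y2 * inverse (t_gen H1))"
    "sigma a b c Hz Hy = gen_Y2 * inverse (t_gen H1)"
    by (simp_all add: simps field_simps power2_eq_square)
  show "sigma a b c Hz Hz = - Q"
    by (simp add: simps Q_def KH.\<iota>_diff KH.\<iota>_power field_simps power2_eq_square)
qed

text \<open>Apart from arguments \<open>H1\<close> and the pair \<open>Hx\<close>,
  \<open>Hx\<close>, each value is up to sign a value of \<open>sigma\<close> divided by X^2, so no
  denominators besides E and X^2 occur.\<close>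

lemma sigma_inv_values:
  defines "P \<equiv> gen_T * inverse (t_gen H1)" and "W \<equiv> gen_U * inverse gen_X2"
  defines "Q \<equiv> KH_const (1 / 4) * (W ^ 2 - KH_const ((b ^ 2 - 4 * a * c) / a) * gen_X2) * inverse (t_gen H1)"
  shows "sigma_inv a b c H1 h = counit h * inverse (t_gen H1)"
    "sigma_inv a b c h H1 = counit h * inverse (t_gen H1)"
    "sigma_inv a b c Hx Hx = t_gen H1 * inverse gen_X2"
    "sigma_inv a b c Hx Hy = - (KH_const (1 / 2) * (P - W) * inverse gen_X2)"
    "sigma_inv a b c Hx Hz = KH_const (1 / 2) * (P - W) * inverse gen_X2"
    "sigma_inv a b c Hy Hx = - (KH_const (1 / 2) * (P + W) * inverse gen_X2)"
    "sigma_inv a b c Hz Hx = - (KH_const (1 / 2) * (P + W) * inverse gen_X2)"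
    "sigma_inv a b c Hy Hy = - (gen_Y2 * inverse (t_gen H1) * inverse gen_X2)"
    "sigma_inv a b c Hy Hz = Q * inverse gen_X2"
    "sigma_inv a b c Hz Hy = - (Q * inverse gen_X2)"
    "sigma_inv a b c Hz Hz = Q * inverse gen_X2"
proof -
  note simps = sigma_inv_def lin_ext_pure_tensor lin_ext_zero t_inv_eqs KH.\<iota>_zero KH.\<iota>_one KH.\<iota>_minus KH.\<iota>_mult
    gen_X2_def gen_Y2_def P_def W_def gen_T_def gen_U_def KH_const_divide KH.\<iota>_numeral t_gen_nonzero KH_a KH_two KH_four
    alpha_inv_values[OF a_nonzero]
  show "sigma_inv a b c H1 h = counit h * inverse (t_gen H1)"
    "sigma_inv a b c h H1 = counit h * inverse (t_gen H1)"
    by (cases h; simp add: simps field_simps)+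
  show "sigma_inv a b c Hx Hx = t_gen H1 * inverse gen_X2"
    "sigma_inv a b c Hx Hy = - (KH_const (1 / 2) * (P - W) * inverse gen_X2)"
    "sigma_inv a b c Hx Hz = KH_const (1 / 2) * (P - W) * inverse gen_X2"
    "sigma_inv a b c Hy Hx = - (KH_const (1 / 2) * (P + W) * inverse gen_X2)"
    "sigma_inv a b c Hz Hx = - (KH_const (1 / 2) * (P + W) * inverse gen_X2)"
    "sigma_inv a b c Hy Hy = - (gen_Y2 * inverse (t_gen H1) * inverse gen_X2)"
    by (simp_all add: simps field_simps power2_eq_square)
  show "sigma_inv a b c Hy Hz = Q * inverse gen_X2"
    "sigma_inv a b c Hz Hy = - (Q * inverse gen_X2)"
    "sigma_inv a b c Hz Hz = Q * inverse gen_X2"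
    by (simp_all add: simps Q_def KH.\<iota>_diff KH.\<iota>_power field_simps power2_eq_square)
qed

lemma sigma_in_BB: "sigma a b c g h \<in> BB" "sigma_inv a b c g h \<in> BB"
  by (cases g; cases h; auto simp: sigma_values sigma_inv_values intro!: BB_intros BB_gens)+

lemma BH_eq_BB: "BH a b c = BB"
proof
  have "bilin_ext f u v \<in> BB" if "\<And>g h. f g h \<in> BB" for f u v
    unfolding bilin_ext_def using that by (simp add: BB_def alg_gen_sum alg_gen_mult alg_gen_const)
  then show "BH a b c \<subseteq> BB"
    unfolding BH_def BB_def by (intro alg_gen_minimal) (auto simp: sigma_in_BB simp flip: BB_def)
next
  have sigma: "sigma a b c g h \<in> BH a b c" for g h
    unfolding BH_def using bilin_ext_pure_tensor[of "sigma a b c" g h, symmetric] by (intro alg_gen_incl) blast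
  have sigma_inv: "sigma_inv a b c g h \<in> BH a b c" for g h
    unfolding BH_def using bilin_ext_pure_tensor[of "sigma_inv a b c" g h, symmetric] by (intro alg_gen_incl) blast
  note intros = alg_gen_intros[where G = "{bilin_ext (sigma a b c) u v |u v. True} \<union>
    {bilin_ext (sigma_inv a b c) u v |u v. True}", folded BH_def]
  have E: "t_gen H1 \<in> BH a b c" "inverse (t_gen H1) \<in> BH a b c"
    using sigma[of H1 H1] sigma_inv[of H1 H1] by (simp_all add: sigma_values sigma_inv_values)
  have "gen_X2 = sigma a b c Hx Hx * t_gen H1" "inverse gen_X2 = sigma_inv a b c Hx Hx * inverse (t_gen H1)"
    "gen_Y2 = sigma a b c Hy Hy * t_gen H1"
    by (simp_all add: sigma_values sigma_inv_values t_gen_nonzero)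
  then have X2: "gen_X2 \<in> BH a b c" "inverse gen_X2 \<in> BH a b c" "gen_Y2 \<in> BH a b c"
    by (simp_all only: sigma sigma_inv E intros)
  \<comment> \<open>The two values are half the difference and half the sum of T / E and U / X^2, so
    adding and subtracting them recovers T and U.\<close>
  have "gen_T = t_gen H1 * (sigma a b c Hx Hy + sigma a b c Hy Hx)"
    "gen_U = gen_X2 * (sigma a b c Hy Hx - sigma a b c Hx Hy)"
    using KH_two KH_four by (simp_all add: sigma_values t_gen_nonzero gen_X2_nonzero KH_const_divide
        KH.\<iota>_one KH.\<iota>_numeral field_simps)
  then have "gen_T \<in> BH a b c" "gen_U \<in> BH a b c"
    by (simp_all only: sigma X2 E intros)
  with E X2 show "BB \<subseteq> BH a b c"
    unfolding BB_def BH_def by (intro alg_gen_minimal) auto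
qed

end

section \<open>Localization of the center\<close>

text \<open>Once \<open>Z\<close> is embedded in a field by \<open>f\<close> and denominators have
  nonzero image, the localization is the set of fractions f z / f s. It is applied with
  \<open>f\<close> the identification \<open>ident\<close>.\<close>

lemma loc_alg_iso:
  fixes Z :: "('k, 'a) module" and f :: "'a \<Rightarrow> 'r::field" and \<iota> :: "'k \<Rightarrow> 'r"
  assumes inj: "inj_on f (carrier Z)"
    and mult: "\<And>x y. x \<in> carrier Z \<Longrightarrow> y \<in> carrier Z \<Longrightarrow> x \<otimes>\<^bsub>Z\<^esub> y \<in> carrier Z"
      "\<And>x y. x \<in> carrier Z \<Longrightarrow> y \<in> carrier Z \<Longrightarrow> f (x \<otimes>\<^bsub>Z\<^esub> y) = f x * f y"
    and add: "\<And>x y. x \<in> carrier Z \<Longrightarrow> y \<in> carrier Z \<Longrightarrow> x \<oplus>\<^bsub>Z\<^esub> y \<in> carrier Z"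
      "\<And>x y. x \<in> carrier Z \<Longrightarrow> y \<in> carrier Z \<Longrightarrow> f (x \<oplus>\<^bsub>Z\<^esub> y) = f x + f y"
    and smult: "\<And>k x. x \<in> carrier Z \<Longrightarrow> k \<odot>\<^bsub>Z\<^esub> x \<in> carrier Z"
      "\<And>k x. x \<in> carrier Z \<Longrightarrow> f (k \<odot>\<^bsub>Z\<^esub> x) = \<iota> k * f x"
    and one: "f \<one>\<^bsub>Z\<^esub> = 1"
    and S: "submonoid S Z" and nonzero: "\<And>s. s \<in> S \<Longrightarrow> f s \<noteq> 0"
    and B: "B = {f z / f s |z s. z \<in> carrier Z \<and> s \<in> S}"
  shows "\<exists>\<phi> \<in> alg_iso (loc_alg Z S) (type_alg \<iota>\<lparr>carrier := B\<rparr>).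
    \<forall>z \<in> carrier Z. \<phi> (loc_frac Z S z \<one>\<^bsub>Z\<^esub>) = f z"
proof -
  let ?frac = "loc_frac Z S"
  have S_carrier: "s \<in> carrier Z" if "s \<in> S" for s
    using S that by (meson submonoid.mem_carrier)
  have S_mult: "s \<otimes>\<^bsub>Z\<^esub> s' \<in> S" if "s \<in> S" "s' \<in> S" for s s'
    using S that by (meson submonoid.m_closed)
  have S_one: "\<one>\<^bsub>Z\<^esub> \<in> S"
    using S by (meson submonoid.one_closed)
  \<comment> \<open>Injectivity of \<open>f\<close> moves the defining equation into the field,
    where the factor f t cancels. A class is therefore a fibre of the fraction map.\<close>
  have frac_eq: "?frac r s = {(r', s'). r' \<in> carrier Z \<and> s' \<in> S \<and> f r' / f s' = f r / f s}"
    if r: "r \<in> carrier Z" and s: "s \<in> S" for r s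
  proof -
    have "(\<exists>t\<in>S. t \<otimes>\<^bsub>Z\<^esub> (r \<otimes>\<^bsub>Z\<^esub> s') = t \<otimes>\<^bsub>Z\<^esub> (r' \<otimes>\<^bsub>Z\<^esub> s)) \<longleftrightarrow> f r' / f s' = f r / f s"
      if r': "r' \<in> carrier Z" and s': "s' \<in> S" for r' s'
    proof -
      have "t \<otimes>\<^bsub>Z\<^esub> (r \<otimes>\<^bsub>Z\<^esub> s') = t \<otimes>\<^bsub>Z\<^esub> (r' \<otimes>\<^bsub>Z\<^esub> s) \<longleftrightarrow> f r' / f s' = f r / f s" if t: "t \<in> S" for t
      proof -
        note mem = r r' S_carrier[OF s] S_carrier[OF s'] S_carrier[OF t]
        have "t \<otimes>\<^bsub>Z\<^esub> (r \<otimes>\<^bsub>Z\<^esub> s') = t \<otimes>\<^bsub>Z\<^esub> (r' \<otimes>\<^bsub>Z\<^esub> s) \<longleftrightarrow>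
            f (t \<otimes>\<^bsub>Z\<^esub> (r \<otimes>\<^bsub>Z\<^esub> s')) = f (t \<otimes>\<^bsub>Z\<^esub> (r' \<otimes>\<^bsub>Z\<^esub> s))"
          by (rule inj_on_eq_iff[OF inj, symmetric]) (simp_all add: mem mult)
        also have "\<dots> \<longleftrightarrow> f r' / f s' = f r / f s"
          using nonzero[OF s] nonzero[OF s'] nonzero[OF t] by (simp add: mem mult field_simps) auto
        finally show ?thesis .
      qed
      then show ?thesis
        using S_one by blast
    qed
    then show ?thesis
      using r s by (auto simp: loc_frac_def loc_rel_def)
  qed
  have frac_cong: "?frac r s = ?frac r' s'"
    if "r \<in> carrier Z" "s \<in> S" "r' \<in> carrier Z" "s' \<in> S" "f r / f s = f r' / f s'" for r s r' s'
    using that by (simp add: frac_eq)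
  define \<phi> where "\<phi> C = the_elem ((\<lambda>(r, s). f r / f s) ` C)" for C
  have \<phi>: "\<phi> (?frac r s) = f r / f s" if "r \<in> carrier Z" "s \<in> S" for r s
  proof -
    have "(\<lambda>(r, s). f r / f s) ` ?frac r s = {f r / f s}"
      using that by (force simp: frac_eq)
    then show ?thesis
      by (simp add: \<phi>_def)
  qed
  have carrier_loc: "carrier (loc_alg Z S) = {?frac r s |r s. r \<in> carrier Z \<and> s \<in> S}"
    by (auto simp: loc_alg_def quotient_def loc_frac_def)
  \<comment> \<open>A union of a constant family over a nonempty class; this and \<open>UN2\<close>
    evaluate the operations of \<open>loc_alg\<close> on representatives.\<close>
  have UN1: "(\<Union>(r', s')\<in>?frac r s. h r' s') = D"
    if "r \<in> carrier Z" "s \<in> S"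
      and "\<And>r' s'. r' \<in> carrier Z \<Longrightarrow> s' \<in> S \<Longrightarrow> f r' / f s' = f r / f s \<Longrightarrow> h r' s' = D"
    for r s D and h :: "'a \<Rightarrow> 'a \<Rightarrow> ('a \<times> 'a) set"
  proof -
    have "(r, s) \<in> ?frac r s" using that by (simp add: frac_eq)
    then show ?thesis using that by (force simp: frac_eq)
  qed
  have UN2: "(\<Union>(p, q)\<in>?frac r s. \<Union>(p', q')\<in>?frac r' s'. h p q p' q') = D"
    if r: "r \<in> carrier Z" "s \<in> S" and r': "r' \<in> carrier Z" "s' \<in> S"
      and h: "\<And>p q p' q'. p \<in> carrier Z \<Longrightarrow> q \<in> S \<Longrightarrow> f p / f q = f r / f s \<Longrightarrow>
        p' \<in> carrier Z \<Longrightarrow> q' \<in> S \<Longrightarrow> f p' / f q' = f r' / f s' \<Longrightarrow> h p q p' q' = D"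
    for r s r' s' D and h :: "'a \<Rightarrow> 'a \<Rightarrow> 'a \<Rightarrow> 'a \<Rightarrow> ('a \<times> 'a) set"
  proof -
    have "(\<Union>(p', q')\<in>?frac r' s'. h p q p' q') = D"
      if "p \<in> carrier Z" "q \<in> S" "f p / f q = f r / f s" for p q
      using UN1[OF r', of "h p q" D] h[OF that] by blast
    then show ?thesis
      using UN1[OF r, of "\<lambda>p q. \<Union>(p', q')\<in>?frac r' s'. h p q p' q'" D] by blast
  qed
  have loc_mult: "?frac r s \<otimes>\<^bsub>loc_alg Z S\<^esub> ?frac r' s' = ?frac (r \<otimes>\<^bsub>Z\<^esub> r') (s \<otimes>\<^bsub>Z\<^esub> s')"
    if "r \<in> carrier Z" "s \<in> S" "r' \<in> carrier Z" "s' \<in> S" for r s r' s'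
  proof -
    have "(\<Union>(p, q)\<in>?frac r s. \<Union>(p', q')\<in>?frac r' s'. ?frac (p \<otimes>\<^bsub>Z\<^esub> p') (q \<otimes>\<^bsub>Z\<^esub> q')) =
        ?frac (r \<otimes>\<^bsub>Z\<^esub> r') (s \<otimes>\<^bsub>Z\<^esub> s')"
    proof (rule UN2[OF that])
      fix p q p' q'
      assume *: "p \<in> carrier Z" "q \<in> S" "f p / f q = f r / f s"
        "p' \<in> carrier Z" "q' \<in> S" "f p' / f q' = f r' / f s'"
      then have "f (p \<otimes>\<^bsub>Z\<^esub> p') / f (q \<otimes>\<^bsub>Z\<^esub> q') = f (r \<otimes>\<^bsub>Z\<^esub> r') / f (s \<otimes>\<^bsub>Z\<^esub> s')"
        using that unfolding mult(2)[OF *(1,4)] mult(2)[OF S_carrier[OF *(2)] S_carrier[OF *(5)]]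
        by (simp only: mult S_carrier times_divide_times_eq[symmetric])
      with * that show "?frac (p \<otimes>\<^bsub>Z\<^esub> p') (q \<otimes>\<^bsub>Z\<^esub> q') = ?frac (r \<otimes>\<^bsub>Z\<^esub> r') (s \<otimes>\<^bsub>Z\<^esub> s')"
        by (intro frac_cong) (simp_all add: mult(1) S_mult)
    qed
    then show ?thesis by (simp add: loc_alg_def)
  qed
  have sum_frac: "(u * y + v * x) / (x * y) = u / x + v / y" if "x \<noteq> 0" "y \<noteq> 0" for u v x y :: 'r
    using that by (simp add: field_simps)
  have loc_add: "?frac r s \<oplus>\<^bsub>loc_alg Z S\<^esub> ?frac r' s' =
      ?frac (r \<otimes>\<^bsub>Z\<^esub> s' \<oplus>\<^bsub>Z\<^esub> r' \<otimes>\<^bsub>Z\<^esub> s) (s \<otimes>\<^bsub>Z\<^esub> s')"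
    if "r \<in> carrier Z" "s \<in> S" "r' \<in> carrier Z" "s' \<in> S" for r s r' s'
  proof -
    have "(\<Union>(p, q)\<in>?frac r s. \<Union>(p', q')\<in>?frac r' s'. ?frac (p \<otimes>\<^bsub>Z\<^esub> q' \<oplus>\<^bsub>Z\<^esub> p' \<otimes>\<^bsub>Z\<^esub> q) (q \<otimes>\<^bsub>Z\<^esub> q')) =
        ?frac (r \<otimes>\<^bsub>Z\<^esub> s' \<oplus>\<^bsub>Z\<^esub> r' \<otimes>\<^bsub>Z\<^esub> s) (s \<otimes>\<^bsub>Z\<^esub> s')"
    proof (rule UN2[OF that])
      fix p q p' q'
      assume *: "p \<in> carrier Z" "q \<in> S" "f p / f q = f r / f s"
        "p' \<in> carrier Z" "q' \<in> S" "f p' / f q' = f r' / f s'"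
      then have "f (p \<otimes>\<^bsub>Z\<^esub> q' \<oplus>\<^bsub>Z\<^esub> p' \<otimes>\<^bsub>Z\<^esub> q) / f (q \<otimes>\<^bsub>Z\<^esub> q') =
          f (r \<otimes>\<^bsub>Z\<^esub> s' \<oplus>\<^bsub>Z\<^esub> r' \<otimes>\<^bsub>Z\<^esub> s) / f (s \<otimes>\<^bsub>Z\<^esub> s')"
        using that by (simp only: mult add S_carrier sum_frac nonzero not_False_eq_True)
      with * that show "?frac (p \<otimes>\<^bsub>Z\<^esub> q' \<oplus>\<^bsub>Z\<^esub> p' \<otimes>\<^bsub>Z\<^esub> q) (q \<otimes>\<^bsub>Z\<^esub> q') =
          ?frac (r \<otimes>\<^bsub>Z\<^esub> s' \<oplus>\<^bsub>Z\<^esub> r' \<otimes>\<^bsub>Z\<^esub> s) (s \<otimes>\<^bsub>Z\<^esub> s')"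
        by (intro frac_cong) (simp_all add: mult(1) add(1) S_mult S_carrier)
    qed
    then show ?thesis by (simp add: loc_alg_def)
  qed
  have loc_smult: "k \<odot>\<^bsub>loc_alg Z S\<^esub> ?frac r s = ?frac (k \<odot>\<^bsub>Z\<^esub> r) s"
    if "r \<in> carrier Z" "s \<in> S" for k r s
  proof -
    have "(\<Union>(p, q)\<in>?frac r s. ?frac (k \<odot>\<^bsub>Z\<^esub> p) q) = ?frac (k \<odot>\<^bsub>Z\<^esub> r) s"
    proof (rule UN1[OF that])
      fix p q
      assume *: "p \<in> carrier Z" "q \<in> S" "f p / f q = f r / f s"
      then have "f (k \<odot>\<^bsub>Z\<^esub> p) / f q = f (k \<odot>\<^bsub>Z\<^esub> r) / f s"
        using that by (simp only: smult times_divide_eq_right[symmetric])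
      with * that show "?frac (k \<odot>\<^bsub>Z\<^esub> p) q = ?frac (k \<odot>\<^bsub>Z\<^esub> r) s"
        by (intro frac_cong) (simp_all add: smult(1))
    qed
    then show ?thesis by (simp add: loc_alg_def)
  qed
  have hom: "\<phi> \<in> ring_hom (loc_alg Z S) (type_alg \<iota>\<lparr>carrier := B\<rparr>)"
  proof (rule ring_hom_memI)
    fix C assume "C \<in> carrier (loc_alg Z S)"
    then obtain r s where r: "C = ?frac r s" "r \<in> carrier Z" "s \<in> S"
      unfolding carrier_loc by blast
    then show "\<phi> C \<in> carrier (type_alg \<iota>\<lparr>carrier := B\<rparr>)"
      unfolding B by (auto simp: \<phi>)
    fix D assume "D \<in> carrier (loc_alg Z S)"
    then obtain r' s' where r': "D = ?frac r' s'" "r' \<in> carrier Z" "s' \<in> S"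
      unfolding carrier_loc by blast
    show "\<phi> (C \<otimes>\<^bsub>loc_alg Z S\<^esub> D) = \<phi> C \<otimes>\<^bsub>type_alg \<iota>\<lparr>carrier := B\<rparr>\<^esub> \<phi> D"
      using r(2,3) r'(2,3) unfolding r(1) r'(1)
      by (simp add: loc_mult \<phi> mult S_mult S_carrier type_alg_def)
    show "\<phi> (C \<oplus>\<^bsub>loc_alg Z S\<^esub> D) = \<phi> C \<oplus>\<^bsub>type_alg \<iota>\<lparr>carrier := B\<rparr>\<^esub> \<phi> D"
      using r(2,3) r'(2,3) unfolding r(1) r'(1)
      by (simp add: loc_add \<phi> mult add S_mult S_carrier sum_frac nonzero type_alg_def)
  next
    show "\<phi> \<one>\<^bsub>loc_alg Z S\<^esub> = \<one>\<^bsub>type_alg \<iota>\<lparr>carrier := B\<rparr>\<^esub>"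
      using \<phi>[OF S_carrier[OF S_one] S_one] by (simp add: loc_alg_def type_alg_def one)
  qed
  have "\<phi> (k \<odot>\<^bsub>loc_alg Z S\<^esub> C) = k \<odot>\<^bsub>type_alg \<iota>\<lparr>carrier := B\<rparr>\<^esub> \<phi> C"
    if C: "C \<in> carrier (loc_alg Z S)" for k C
  proof -
    obtain r s where r: "C = ?frac r s" "r \<in> carrier Z" "s \<in> S"
      using C unfolding carrier_loc by blast
    show ?thesis
      using r(2,3) unfolding r(1) by (simp add: loc_smult \<phi> smult type_alg_def)
  qed
  moreover have "bij_betw \<phi> (carrier (loc_alg Z S)) (carrier (type_alg \<iota>\<lparr>carrier := B\<rparr>))"
  proof (rule bij_betw_imageI)
    show "inj_on \<phi> (carrier (loc_alg Z S))"
      unfolding carrier_loc by (rule inj_onI) (clarify, rule frac_cong, simp_all add: \<phi>)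
    have "\<phi> ` {?frac r s |r s. r \<in> carrier Z \<and> s \<in> S} = B"
    proof safe
      fix u assume "u \<in> B"
      then obtain z s where "u = f z / f s" "z \<in> carrier Z" "s \<in> S"
        unfolding B by blast
      then show "u \<in> \<phi> ` {?frac r s |r s. r \<in> carrier Z \<and> s \<in> S}"
        using \<phi> by (intro image_eqI[of _ _ "?frac z s"]) auto
    next
      fix r s assume "r \<in> carrier Z" "s \<in> S"
      then show "\<phi> (?frac r s) \<in> B"
        unfolding B by (auto simp: \<phi>)
    qed
    then show "\<phi> ` carrier (loc_alg Z S) = carrier (type_alg \<iota>\<lparr>carrier := B\<rparr>)"
      by (simp add: carrier_loc)
  qed
  ultimately have "\<phi> \<in> alg_iso (loc_alg Z S) (type_alg \<iota>\<lparr>carrier := B\<rparr>)"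
    using hom by (simp add: alg_iso_def alg_hom_def)
  moreover have "\<phi> (?frac z \<one>\<^bsub>Z\<^esub>) = f z" if "z \<in> carrier Z" for z
    using \<phi>[OF that S_one] by (simp add: one)
  ultimately show ?thesis by blast
qed

section \<open>Parity of nu, and the fractions of the center\<close>

context sweedler_cocycle
begin

text \<open>With \<open>v = y - \<beta>x\<close>, the four expressions are the coefficients of \<open>1\<close>, \<open>x\<close>, \<open>v\<close>, \<open>xv\<close> in \<open>\<nu> P\<close>,
  the two odd ones multiplied by \<open>t\<^sub>x\<close>.\<close>

lemma nu_parity:
  defines "\<beta> \<equiv> KH_const (b / (2 * a))"
  shows "\<nu> P H1 + KH_const a * \<beta> * \<nu> P Hz \<in> BB \<and> (\<nu> P Hx + \<beta> * \<nu> P Hy) * t_gen Hx \<in> BB \<and>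
    \<nu> P Hy \<in> BB \<and> \<nu> P Hz * t_gen Hx \<in> BB"
proof (induction P rule: TX_induct)
  case (const k)
  have "\<nu> (pconst k) = pure_tensor (KH_const k) H1"
    by (simp add: nu_def KH_twisted.free_lift_pconst)
  then show ?case
    by (simp add: pure_tensor_def BB_intros)
next
  case (gen s)
  \<comment> \<open>The coefficients that arise from letters: with z = x v + a \<beta>, nu(Y) is t_1
    v + (t_y + \<beta> t_1) x and nu(Z) is t_x x v + (t_z + a \<beta> t_x). They give t_x^2 = X^2 /
    a, t_x s / (2a) and w / 2.\<close>
  have "t_gen Hx * t_gen Hx = KH_const (inverse a) * gen_X2"
    using KH_a by (simp add: gen_X2_def KH_const_inverse power2_eq_square)
  moreover have "(t_gen Hy + \<beta> * t_gen H1) * t_gen Hx = KH_const (1 / (2 * a)) * gen_T"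
    using KH_a KH_two by (simp add: gen_T_def \<beta>_def KH_const_divide KH.\<iota>_mult KH.\<iota>_numeral KH.\<iota>_one field_simps)
  moreover have "t_gen Hz + KH_const a * \<beta> * t_gen Hx = KH_const (1 / 2) * (gen_U * inverse gen_X2)"
    using KH_a KH_two gen_X2_nonzero
    by (simp add: gen_U_def \<beta>_def KH_const_divide KH.\<iota>_mult KH.\<iota>_numeral KH.\<iota>_one field_simps)
  ultimately show ?case
    by (cases s) (simp_all add: nu_Xvar_values BB_intros BB_gens)
next
  case (add P Q)
  have "\<nu> (P + Q) r = \<nu> P r + \<nu> Q r" for r
    by (simp add: nu_add)
  moreover note add.IH
  ultimately show ?case
    using BB_intros(2)[of "\<nu> P H1 + KH_const a * \<beta> * \<nu> P Hz" "\<nu> Q H1 + KH_const a * \<beta> * \<nu> Q Hz"]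
      BB_intros(2)[of "(\<nu> P Hx + \<beta> * \<nu> P Hy) * t_gen Hx" "(\<nu> Q Hx + \<beta> * \<nu> Q Hy) * t_gen Hx"]
      BB_intros(2)[of "\<nu> P Hy" "\<nu> Q Hy"] BB_intros(2)[of "\<nu> P Hz * t_gen Hx" "\<nu> Q Hz * t_gen Hx"]
    by (simp add: algebra_simps)
next
  case (mult P Q)
  \<comment> \<open>Coordinates in the basis 1, x, v, x v; indices 0 and 2 are even, 1 and 3
    odd.\<close>
  define p0 p1 p2 p3 where p: "p0 = \<nu> P H1 + KH_const a * \<beta> * \<nu> P Hz" "p1 = \<nu> P Hx + \<beta> * \<nu> P Hy"
    "p2 = \<nu> P Hy" "p3 = \<nu> P Hz"
  define q0 q1 q2 q3 where q: "q0 = \<nu> Q H1 + KH_const a * \<beta> * \<nu> Q Hz" "q1 = \<nu> Q Hx + \<beta> * \<nu> Q Hy"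
    "q2 = \<nu> Q Hy" "q3 = \<nu> Q Hz"
  have even: "p0 \<in> BB" "p2 \<in> BB" "q0 \<in> BB" "q2 \<in> BB"
    and odd: "p1 * t_gen Hx \<in> BB" "p3 * t_gen Hx \<in> BB" "q1 * t_gen Hx \<in> BB" "q3 * t_gen Hx \<in> BB"
    using mult.IH by (simp_all add: p q)
  have odd_odd: "u * v \<in> BB" if "u * t_gen Hx \<in> BB" "v * t_gen Hx \<in> BB" for u v
  proof -
    have "KH_const a * inverse gen_X2 * ((u * t_gen Hx) * (v * t_gen Hx)) \<in> BB"
      by (intro BB_intros BB_gens that)
    also have "KH_const a * inverse gen_X2 * ((u * t_gen Hx) * (v * t_gen Hx)) = u * v"
      using KH_a by (simp add: gen_X2_def t_gen_nonzero field_simps power2_eq_square)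
    finally show ?thesis .
  qed
  have even_odd: "u * v * t_gen Hx \<in> BB" if "u \<in> BB" "v * t_gen Hx \<in> BB" for u v
    using BB_intros(3)[OF that] by (simp add: mult.assoc)
  \<comment> \<open>This is v^2. As b = 2 a \<beta>, also x v + v x = 0, so the four coordinate
    formulas of the product below are homogeneous.\<close>
  define \<kappa> where "\<kappa> = KH_const c - KH_const a * \<beta> * \<beta>"
  have b_eq: "KH_const b = 2 * KH_const a * \<beta>"
    using KH_a KH_two by (simp add: \<beta>_def KH_const_divide KH.\<iota>_mult KH.\<iota>_numeral)
  have c_eq: "KH_const c = \<kappa> + KH_const a * \<beta> * \<beta>"
    by (simp add: \<kappa>_def)
  have "\<nu> (P * Q) H1 + KH_const a * \<beta> * \<nu> (P * Q) Hz =
      p0 * q0 + KH_const a * (p1 * q1) + \<kappa> * (p2 * q2) - KH_const a * \<kappa> * (p3 * q3)"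
    "(\<nu> (P * Q) Hx + \<beta> * \<nu> (P * Q) Hy) * t_gen Hx =
      p0 * q1 * t_gen Hx + q0 * p1 * t_gen Hx - \<kappa> * (p2 * q3 * t_gen Hx) + \<kappa> * (q2 * p3 * t_gen Hx)"
    "\<nu> (P * Q) Hy = p0 * q2 + p2 * q0 + KH_const a * (p1 * q3) - KH_const a * (p3 * q1)"
    "\<nu> (P * Q) Hz * t_gen Hx =
      p0 * q3 * t_gen Hx + q0 * p3 * t_gen Hx + q2 * p1 * t_gen Hx - p2 * q1 * t_gen Hx"
    unfolding nu_mult_values b_eq c_eq p q by (simp_all add: algebra_simps)
  moreover have "\<kappa> \<in> BB"
    by (simp add: \<kappa>_def \<beta>_def BB_intros)
  ultimately show ?case
    using even odd by (simp add: BB_intros odd_odd even_odd)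
qed

text \<open>For a central class the coordinates other than the one at 1 vanish, so the first
  expression in \<open>nu_parity\<close> is the identified element itself.\<close>

lemma ident_in_BB:
  assumes "C \<in> carrier Z"
  shows "ident a b c C \<in> BB"
proof -
  obtain P q where P: "\<nu> P = pure_tensor q H1" "ident a b c C = q"
    using assms by (rule ZH_cases)
  then show ?thesis
    using nu_parity[of P] by (simp add: pure_tensor_def)
qed

lemma nu_generators:
  "\<nu> (Xvar H1) = pure_tensor (t_gen H1) H1"
  "\<nu> (Xvar Hx ^ 2) = pure_tensor gen_X2 H1"
  "\<nu> (Xvar Hy ^ 2) = pure_tensor gen_Y2 H1"
  "\<nu> (Xvar Hx * Xvar Hy + Xvar Hy * Xvar Hx) = pure_tensor gen_T H1"
  "\<nu> (Xvar Hx * (Xvar Hx * Xvar Hz + Xvar Hz * Xvar Hx)) = pure_tensor gen_U H1"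
  by (rule ext, rename_tac r, case_tac r;
      simp add: power2_eq_square nu_mult_values nu_add nu_Xvar_values pure_tensor_def
        gen_X2_def gen_Y2_def gen_T_def gen_U_def algebra_simps)+

lemma ident_generators:
  "ident a b c (U_E a b c) = t_gen H1" "ident a b c (U_X2 a b c) = gen_X2" "ident a b c (U_Y2 a b c) = gen_Y2"
  "ident a b c (U_T a b c) = gen_T" "ident a b c (U_U a b c) = gen_U"
  unfolding U_E_def U_X2_def U_Y2_def U_T_def U_U_def by (intro ident_UH_class nu_generators)+

lemma generators_in_ZH:
  "U_E a b c \<in> carrier Z" "U_X2 a b c \<in> carrier Z" "U_Y2 a b c \<in> carrier Z"
  "U_T a b c \<in> carrier Z" "U_U a b c \<in> carrier Z"
  unfolding U_E_def U_X2_def U_Y2_def U_T_def U_U_def by (rule ZH_memI nu_generators)+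

abbreviation "denoms \<equiv> submonoid_gen Z {U_E a b c, U_X2 a b c}"

lemma submonoid_denoms: "submonoid denoms Z"
  and denoms_gens: "U_E a b c \<in> denoms" "U_X2 a b c \<in> denoms"
proof -
  have "submonoid (carrier Z) Z"
    by (rule submonoid.intro) (simp_all add: ident_ops ident_one)
  then have "denoms \<subseteq> carrier Z"
    unfolding submonoid_gen_def using generators_in_ZH by (intro hull_minimal) auto
  then show "submonoid denoms Z"
    unfolding submonoid_gen_def hull_def
    by (intro submonoid.intro) (auto intro: submonoid.m_closed submonoid.one_closed)
  show "U_E a b c \<in> denoms" "U_X2 a b c \<in> denoms"
    unfolding submonoid_gen_def by (rule hull_inc; simp)+
qed

text \<open>Monomials in E and X^2 are invertible in \<open>BB\<close>; this is what puts all
  fractions there.\<close>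

lemma ident_denoms:
  assumes "s \<in> denoms"
  obtains m n where "ident a b c s = t_gen H1 ^ m * gen_X2 ^ n"
proof -
  let ?M = "{s \<in> carrier Z. \<exists>m n. ident a b c s = t_gen H1 ^ m * gen_X2 ^ n}"
  have "submonoid ?M Z"
  proof (rule submonoid.intro)
    show "x \<otimes>\<^bsub>Z\<^esub> y \<in> ?M" if x: "x \<in> ?M" and y: "y \<in> ?M" for x y
    proof -
      obtain m n m' n' where "ident a b c x = t_gen H1 ^ m * gen_X2 ^ n" "ident a b c y = t_gen H1 ^ m' * gen_X2 ^ n'"
        using x y by blast
      then have "ident a b c (x \<otimes>\<^bsub>Z\<^esub> y) = t_gen H1 ^ (m + m') * gen_X2 ^ (n + n')"
        using x y by (simp add: ident_ops power_add)
      then show ?thesis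
        using x y ident_ops(1) by blast
    qed
    have "ident a b c \<one>\<^bsub>Z\<^esub> = t_gen H1 ^ 0 * gen_X2 ^ 0"
      by (simp add: ident_one)
    then show "\<one>\<^bsub>Z\<^esub> \<in> ?M"
      using ident_one(1) by blast
  qed auto
  moreover have "ident a b c (U_E a b c) = t_gen H1 ^ 1 * gen_X2 ^ 0"
    "ident a b c (U_X2 a b c) = t_gen H1 ^ 0 * gen_X2 ^ 1"
    by (simp_all add: ident_generators)
  then have "{U_E a b c, U_X2 a b c} \<subseteq> ?M"
    using generators_in_ZH by blast
  ultimately have "denoms \<subseteq> ?M"
    unfolding submonoid_gen_def by (intro hull_minimal)
  with assms that show ?thesis by blast
qed

lemma ident_denoms_nonzero: "s \<in> denoms \<Longrightarrow> ident a b c s \<noteq> 0"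
  by (erule ident_denoms) (simp add: t_gen_nonzero gen_X2_nonzero)

text \<open>The fractions form a subalgebra containing the generators and the two inverses.
  Conversely, numerators lie in \<open>BB\<close> by parity and denominators are invertible in
  it.\<close>

lemma BB_eq_fractions:
  "BB = {ident a b c z / ident a b c s |z s. z \<in> carrier Z \<and> s \<in> denoms}" (is "_ = ?F")
proof
  interpret denoms: submonoid denoms Z
    by (rule submonoid_denoms)
  have FI: "u \<in> ?F" if "z \<in> carrier Z" "s \<in> denoms" "u = ident a b c z / ident a b c s" for u z s
    using that by blast
  have "unital_subalgebra ?F KH_alg"
    unfolding unital_subalgebra_KH_alg
  proof (intro conjI ballI allI)
    show "KH_const k \<in> ?F" for k
      by (rule FI[of "k \<odot>\<^bsub>Z\<^esub> \<one>\<^bsub>Z\<^esub>" "\<one>\<^bsub>Z\<^esub>"]) (simp_all add: ident_smult ident_one denoms.one_closed)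
    fix u v assume "u \<in> ?F" "v \<in> ?F"
    then obtain z s z' s' where u: "u = ident a b c z / ident a b c s" "z \<in> carrier Z" "s \<in> denoms"
      and v: "v = ident a b c z' / ident a b c s'" "z' \<in> carrier Z" "s' \<in> denoms"
      by blast
    note mem = u v denoms.mem_carrier denoms.m_closed ident_ops ident_denoms_nonzero
    show "u + v \<in> ?F"
      by (rule FI[of "z \<otimes>\<^bsub>Z\<^esub> s' \<oplus>\<^bsub>Z\<^esub> z' \<otimes>\<^bsub>Z\<^esub> s" "s \<otimes>\<^bsub>Z\<^esub> s'"]) (simp_all add: mem field_simps)
    show "u * v \<in> ?F"
      by (rule FI[of "z \<otimes>\<^bsub>Z\<^esub> z'" "s \<otimes>\<^bsub>Z\<^esub> s'"]) (simp_all add: mem)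
  qed
  moreover have gens: "ident a b c z \<in> ?F" if "z \<in> carrier Z" for z
    using that by (intro FI[of z "\<one>\<^bsub>Z\<^esub>"]) (simp_all add: ident_one denoms.one_closed)
  moreover have "inverse (ident a b c s) \<in> ?F" if "s \<in> denoms" for s
    using that by (intro FI[of "\<one>\<^bsub>Z\<^esub>" s]) (simp_all add: ident_one inverse_eq_divide)
  ultimately show "BB \<subseteq> ?F"
    unfolding BB_def alg_gen_def using generators_in_ZH denoms_gens
    by (intro hull_minimal) (auto simp flip: ident_generators)
next
  have "ident a b c z / ident a b c s \<in> BB" if z: "z \<in> carrier Z" and s: "s \<in> denoms" for z s
  proof -
    obtain m n where "ident a b c s = t_gen H1 ^ m * gen_X2 ^ n"
      using s by (rule ident_denoms)
    then have "ident a b c z / ident a b c s = ident a b c z * (inverse (t_gen H1) ^ m * inverse gen_X2 ^ n)"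
      by (simp add: divide_inverse power_inverse)
    then show ?thesis
      using ident_in_BB[OF z] by (simp add: BB_intros BB_gens)
  qed
  then show "?F \<subseteq> BB" by blast
qed

lemma BH_iso_localization:
  "\<exists>\<phi> \<in> alg_iso (loc_alg Z denoms) (BH_alg a b c).
    \<forall>z \<in> carrier Z. \<phi> (loc_frac Z denoms z \<one>\<^bsub>Z\<^esub>) = ident a b c z"
  unfolding BH_alg_def BH_eq_BB KH_alg_def
  by (rule loc_alg_iso)
    (simp_all add: ident_inj ident_ops ident_smult ident_one submonoid_denoms ident_denoms_nonzero BB_eq_fractions)

end

section \<open>Relations between the generators\<close>

lemma power_diff_dvd: "x - y dvd x ^ n - y ^ n" for x y :: "'r::comm_ring_1"
  by (metis dvd_triv_left power_diff_sumr2)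

definition laur_mono :: "'r::field \<Rightarrow> 'r \<Rightarrow> 'r \<Rightarrow> 'r \<Rightarrow> 'r \<Rightarrow> int \<times> int \<times> nat \<times> nat \<times> nat \<Rightarrow> 'r"
  where "laur_mono e x2 y2 tt uu = (\<lambda>(i, j, l, m, n). e powi i * x2 powi j * y2 ^ l * tt ^ m * uu ^ n)"

lemma Laur_eval_eq: "Laur_eval e x2 y2 tt uu = lin_eval (\<lambda>c u. KH_const c * u) (laur_mono e x2 y2 tt uu)"
  by (rule ext) (auto simp: Laur_eval_def lin_eval_def laur_mono_def intro!: sum.cong)

text \<open>Integer powers of \<open>e\<close> and \<open>x2\<close> are additive in the exponent
  because both are nonzero.\<close>

lemma monoid_algebra_eval_laur:
  assumes "e \<noteq> 0" "x2 \<noteq> 0"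
  shows "monoid_algebra_eval (\<lambda>c u. KH_const c * u) (*) (laur_mono e x2 y2 tt uu)"
proof
  show "laur_mono e x2 y2 tt uu (m + n) = laur_mono e x2 y2 tt uu m * laur_mono e x2 y2 tt uu n" for m n
    using assms by (cases m; cases n) (simp add: laur_mono_def power_int_add power_add mult_ac)
qed (simp_all add: KH.\<iota>_add KH.\<iota>_mult algebra_simps)

context
  fixes e x2 y2 tt uu :: "'k::field KH"
  assumes nonzero: "e \<noteq> 0" "x2 \<noteq> 0"
begin

interpretation monoid_algebra_eval "\<lambda>c u. KH_const c * u" "(*)" "laur_mono e x2 y2 tt uu"
  using nonzero by (rule monoid_algebra_eval_laur)

lemma Laur_eval_add: "Laur_eval e x2 y2 tt uu (p + q) = Laur_eval e x2 y2 tt uu p + Laur_eval e x2 y2 tt uu q"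
  unfolding Laur_eval_eq by (rule lin_eval_add)

lemma Laur_eval_mult: "Laur_eval e x2 y2 tt uu (p * q) = Laur_eval e x2 y2 tt uu p * Laur_eval e x2 y2 tt uu q"
  unfolding Laur_eval_eq by (rule lin_eval_mult)

lemma Laur_eval_single: "Laur_eval e x2 y2 tt uu (Poly_Mapping.single k c) = KH_const c * laur_mono e x2 y2 tt uu k"
  unfolding Laur_eval_eq by (rule lin_eval_single)

lemma Laur_eval_diff: "Laur_eval e x2 y2 tt uu (p - q) = Laur_eval e x2 y2 tt uu p - Laur_eval e x2 y2 tt uu q"
  using Laur_eval_add[of "p - q" q] by simp

lemma Laur_eval_pconst: "Laur_eval e x2 y2 tt uu (pconst c) = KH_const c"
  unfolding pconst_def Laur_eval_single by (simp add: laur_mono_def zero_prod_def)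

lemma Laur_eval_gens:
  "Laur_eval e x2 y2 tt uu L_E = e" "Laur_eval e x2 y2 tt uu L_X2 = x2" "Laur_eval e x2 y2 tt uu L_Y2 = y2"
  "Laur_eval e x2 y2 tt uu L_T = tt" "Laur_eval e x2 y2 tt uu L_U = uu"
  unfolding L_E_def L_X2_def L_Y2_def L_T_def L_U_def Laur_eval_single
  by (simp_all add: laur_mono_def KH.\<iota>_one)

end

text \<open>Expressions in E, X^2, T, U and the inverses of the first two: the normal forms modulo
  the relation.\<close>

definition no_Y2 :: "'k::field Laur \<Rightarrow> bool"
  where "no_Y2 p \<longleftrightarrow> (\<forall>k\<in>Poly_Mapping.keys p. fst (snd (snd k)) = 0)"

lemma no_Y2_zero: "no_Y2 0"
  by (simp add: no_Y2_def)

lemma no_Y2_single: "no_Y2 (Poly_Mapping.single (i, j, 0, m, n) c)"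
  by (simp add: no_Y2_def)

lemma no_Y2_add: "no_Y2 p \<Longrightarrow> no_Y2 q \<Longrightarrow> no_Y2 (p + q)"
  using keys_add[of p q] by (auto simp: no_Y2_def)

lemma no_Y2_mult:
  assumes "no_Y2 p" "no_Y2 q"
  shows "no_Y2 (p * q)"
  unfolding no_Y2_def
proof
  fix k assume "k \<in> Poly_Mapping.keys (p * q)"
  then obtain k1 k2 where "k = k1 + k2" "k1 \<in> Poly_Mapping.keys p" "k2 \<in> Poly_Mapping.keys q"
    using keys_mult[of p q] by blast
  then show "fst (snd (snd k)) = 0"
    using assms by (simp add: no_Y2_def)
qed

lemma no_Y2_one: "no_Y2 1"
  using no_Y2_single[of 0 0 0 0 1] by (simp add: zero_prod_def[symmetric])

lemma no_Y2_power: "no_Y2 p \<Longrightarrow> no_Y2 (p ^ n)"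
  by (induction n) (simp_all add: no_Y2_one no_Y2_mult)

lemma L_Y2_power: "L_Y2 ^ l = Poly_Mapping.single (0, 0, l, 0, 0) 1"
proof (induction l)
  case 0
  show ?case by (simp flip: zero_prod_def)
next
  case (Suc l)
  then show ?case by (simp add: L_Y2_def mult_single)
qed

text \<open>Substituting Q for Y^2 changes a monomial by a multiple of (Y^2)^l - Q^l, hence of Y^2 -
  Q.\<close>

lemma Laur_reduce:
  fixes Q :: "'k::field Laur"
  assumes "no_Y2 Q" and dvd: "\<rho> dvd L_Y2 - Q"
  shows "\<exists>p'. no_Y2 p' \<and> \<rho> dvd p - p'"
proof (induction p rule: poly_mapping_single_induct)
  case zero
  show ?case
    using no_Y2_zero by (intro exI[of _ 0]) simp
next
  case (single k c)
  obtain i j l m n where k: "k = (i, j, l, m, n)"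
    by (cases k)
  let ?s = "Poly_Mapping.single (i, j, 0, m, n) c"
  have "Poly_Mapping.single k c - ?s * Q ^ l = ?s * (L_Y2 ^ l - Q ^ l)"
    by (simp add: k L_Y2_power mult_single right_diff_distrib)
  moreover have "\<rho> dvd L_Y2 ^ l - Q ^ l"
    using dvd power_diff_dvd by (rule dvd_trans)
  ultimately have "\<rho> dvd Poly_Mapping.single k c - ?s * Q ^ l"
    by (simp add: dvd_mult)
  then show ?case
    using assms(1) no_Y2_single no_Y2_mult no_Y2_power by blast
next
  case (add p q)
  then obtain p' q' where "no_Y2 p'" "\<rho> dvd p - p'" "no_Y2 q'" "\<rho> dvd q - q'"
    by blast
  moreover from this have "\<rho> dvd (p + q) - (p' + q')"
    using dvd_add[of \<rho> "p - p'" "q - q'"] by (simp add: algebra_simps)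
  ultimately show ?case
    using no_Y2_add by blast
qed

section \<open>The relation and the kernel of the evaluation at the generators\<close>

context sweedler_cocycle
begin

abbreviation "ev \<equiv> Laur_eval (t_gen H1) gen_X2 gen_Y2 gen_T gen_U"

definition relation :: "'k Laur" where
  "relation = L_T ^ 2 - 4 * L_X2 * L_Y2 - pconst ((b ^ 2 - 4 * a * c) / a) * L_E ^ 2 * L_X2"

lemma ev_relation: "ev relation = 0"
proof -
  note ev = Laur_eval_add[OF t_gen_nonzero gen_X2_nonzero] Laur_eval_mult[OF t_gen_nonzero gen_X2_nonzero]
    Laur_eval_diff[OF t_gen_nonzero gen_X2_nonzero] Laur_eval_pconst[OF t_gen_nonzero gen_X2_nonzero]
    Laur_eval_gens[OF t_gen_nonzero gen_X2_nonzero]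
  \<comment> \<open>\<open>ev\<close> is known on scalars \<open>pconst k\<close> only, so the
    numeral 4 is treated as one.\<close>
  have "ev (pconst 4) = KH_const 4"
    by (rule ev)
  then have "ev 4 = 4"
    by (simp only: pconst.\<iota>_numeral KH.\<iota>_numeral)
  then have "ev relation = gen_T * gen_T - 4 * gen_X2 * gen_Y2 -
      KH_const ((b * b - 4 * a * c) / a) * (t_gen H1 * t_gen H1) * gen_X2"
    unfolding relation_def power2_eq_square by (simp only: ev)
  also have "\<dots> = 0"
    using KH_a by (simp add: gen_X2_def gen_Y2_def gen_T_def KH_const_divide KH.\<iota>_diff KH.\<iota>_mult
        KH.\<iota>_numeral field_simps power2_eq_square)
  finally show ?thesis .
qed

text \<open>Since \<open>X\<^sup>2\<close> is invertible, the relation solves for \<open>Y\<^sup>2\<close>.\<close>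

lemma relation_solves_Y2:
  obtains Q where "no_Y2 Q" "relation dvd L_Y2 - Q"
proof
  let ?XI = "Poly_Mapping.single (0, -1, 0, 0, 0) 1 :: 'k Laur"
  let ?q = "pconst (1 / 4) :: 'k Laur"
  let ?d = "pconst ((b ^ 2 - 4 * a * c) / a) :: 'k Laur"
  \<comment> \<open>The solution of the relation for Y^2; multiplying the relation by -(1/4) X^(-2)
    turns it into Y^2 - Q.\<close>
  let ?Q = "?q * (L_T ^ 2 * ?XI - ?d * L_E ^ 2)"
  have "4 \<noteq> (0 :: 'k)"
  proof -
    have "(4 :: 'k) = 2 * 2" by simp
    then show ?thesis using two_neq_zero[OF char_k] by (metis mult_eq_0_iff)
  qed
  then have q: "4 * ?q = 1"
    using pconst.\<iota>_mult[of 4 "1 / 4 :: 'k"] by (simp add: pconst.\<iota>_numeral pconst.\<iota>_one)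
  have XI: "L_X2 * ?XI = 1"
    by (simp add: L_X2_def mult_single flip: zero_prod_def)
  have "relation * (- (?q * ?XI)) =
      (4 * ?q) * (L_X2 * ?XI) * L_Y2 - ?q * (L_T ^ 2 * ?XI) + ?q * ?d * L_E ^ 2 * (L_X2 * ?XI)"
    by (simp add: relation_def algebra_simps)
  also have "\<dots> = L_Y2 - ?Q"
    unfolding q XI by (simp add: algebra_simps)
  finally show "relation dvd L_Y2 - ?Q"
    by (metis dvd_triv_left)
  have "no_Y2 (pconst k)" for k :: 'k
    using no_Y2_single[of 0 0 0 0 k] by (simp add: pconst_def flip: zero_prod_def)
  moreover have "no_Y2 (L_T :: 'k Laur)" "no_Y2 (L_E :: 'k Laur)" "no_Y2 ?XI"
    unfolding L_T_def L_E_def by (rule no_Y2_single)+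
  moreover have "?Q = ?q * (L_T ^ 2 * ?XI + pconst (- 1) * (?d * L_E ^ 2))"
    by (simp add: pconst.\<iota>_minus pconst.\<iota>_one)
  ultimately show "no_Y2 ?Q"
    by (simp only: no_Y2_mult no_Y2_add no_Y2_power)
qed

text \<open>Independence of E, X^2, T, U. Negative exponents are cleared by (E X^2)^D, and the
  resulting polynomial \<open>p'\<close> in the t variables is evaluated at points where E, X^2, T,
  U take prescribed values x, y, z, w.\<close>

lemma ev_eq_zero_imp_zero:
  assumes "no_Y2 p" and zero: "ev p = 0"
  shows "p = 0"
proof (rule ccontr)
  assume "p \<noteq> 0"
  then obtain k0 where k0: "k0 \<in> Poly_Mapping.keys p"
    by (metis all_not_in_conv keys_eq_empty)
  let ?K = "Poly_Mapping.keys p"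
  let ?c = "Poly_Mapping.lookup p"
  \<comment> \<open>Bounds every exponent of E and X^2 in absolute value, so the shifted exponents
    below lose nothing under \<open>nat\<close>.\<close>
  define D where "D = (\<Sum>k\<in>?K. nat \<bar>fst k\<bar> + nat \<bar>fst (snd k)\<bar>)"
  have D: "0 \<le> fst k + int D" "0 \<le> fst (snd k) + int D" if "k \<in> ?K" for k
    using member_le_sum[OF that, of "\<lambda>k. nat \<bar>fst k\<bar> + nat \<bar>fst (snd k)\<bar>"] by (auto simp: D_def[symmetric])
  define d1 d2 d3 d4 where "d1 k = nat (fst k + int D)" and "d2 k = nat (fst (snd k) + int D)"
    and "d3 k = fst (snd (snd (snd k)))" and "d4 k = snd (snd (snd (snd k)))" for k :: "int \<times> int \<times> nat \<times> nat \<times> nat"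
  define X2 T U where "X2 = pconst a * tvar Hx ^ 2"
    and "T = tvar Hx * (2 * pconst a * tvar Hy + pconst b * tvar H1)"
    and "U = X2 * (2 * tvar Hz + pconst b * tvar Hx)"
  define p' where "p' = (\<Sum>k\<in>?K. pconst (?c k) * tvar H1 ^ d1 k * X2 ^ d2 k * T ^ d3 k * U ^ d4 k)"
  have power: "St_to_KH (q ^ n) = St_to_KH q ^ n" for q :: "'k St" and n
    by (induction n) (simp_all add: St_to_KH_mult)
  have sum: "St_to_KH (sum f A) = (\<Sum>k\<in>A. St_to_KH (f k))" for f :: "_ \<Rightarrow> 'k St" and A
    by (induction A rule: infinite_finite_induct) (simp_all add: St_to_KH_add)
  have two: "St_to_KH (2 :: 'k St) = 2"
  proof -
    have "KH_const (2 :: 'k) = 2"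
      by (rule KH.\<iota>_numeral)
    then show ?thesis
      by (simp only: KH_const_def pconst.\<iota>_numeral)
  qed
  have gens: "St_to_KH (tvar s) = t_gen s" "St_to_KH (pconst k) = KH_const k"
    "St_to_KH X2 = gen_X2" "St_to_KH T = gen_T" "St_to_KH U = gen_U" for s k
    by (simp_all add: t_gen_def KH_const_def X2_def T_def U_def gen_X2_def gen_T_def gen_U_def
        St_to_KH_mult St_to_KH_add power two)
  have "St_to_KH p' = t_gen H1 ^ D * gen_X2 ^ D * ev p"
  proof -
    have "KH_const (?c k) * t_gen H1 ^ d1 k * gen_X2 ^ d2 k * gen_T ^ d3 k * gen_U ^ d4 k =
        t_gen H1 ^ D * gen_X2 ^ D * (KH_const (?c k) * laur_mono (t_gen H1) gen_X2 gen_Y2 gen_T gen_U k)"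
      if k: "k \<in> ?K" for k
    proof -
      have power_shift: "u ^ nat (i + int D) = u powi i * u ^ D" if "u \<noteq> 0" "0 \<le> i + int D" for u :: "'k KH" and i
      proof -
        have "u ^ nat (i + int D) = u powi (i + int D)"
          using that by (simp add: power_int_def)
        then show ?thesis
          using that by (simp add: power_int_add)
      qed
      have "t_gen H1 ^ d1 k = (t_gen H1 :: 'k KH) powi (fst k) * t_gen H1 ^ D"
        unfolding d1_def by (rule power_shift[OF t_gen_nonzero D(1)[OF k]])
      moreover have "gen_X2 ^ d2 k = gen_X2 powi (fst (snd k)) * gen_X2 ^ D"
        unfolding d2_def by (rule power_shift[OF gen_X2_nonzero D(2)[OF k]])
      moreover have "fst (snd (snd k)) = 0"
        using assms(1) k by (simp add: no_Y2_def)
      ultimately show ?thesis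
        by (simp add: laur_mono_def d3_def d4_def split_beta mult_ac)
    qed
    then show ?thesis
      unfolding p'_def sum St_to_KH_mult power gens Laur_eval_eq lin_eval_def sum_distrib_left
      by (rule sum.cong[OF refl])
  qed
  then have "p' = 0"
    using zero St_to_KH_eq_iff[of p' 0] by simp
  have two_k: "(2 :: 'k) \<noteq> 0"
    using two_neq_zero[OF char_k] .
  have point_two: "point_eval l 2 = 2" for l :: "sw \<Rightarrow> 'k"
    using point_eval_pconst[of l 2] by (simp add: pconst.\<iota>_numeral)
  \<comment> \<open>The values of X^2 at points with t_x nonzero. The set is infinite since a fibre
    consists of roots of a \<tau>^2 - y.\<close>
  define S where "S = (\<lambda>\<tau>. a * \<tau> ^ 2) ` (UNIV - {0})"
  have "infinite S"
  proof
    assume "finite S"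
    moreover have "infinite (UNIV - {0 :: 'k})"
      using infinite_k by simp
    ultimately obtain y where y: "infinite ((\<lambda>\<tau>. a * \<tau> ^ 2) -` {y} \<inter> (UNIV - {0}))"
      unfolding S_def using inf_img_fin_dom' by blast
    have "(\<lambda>\<tau>. a * \<tau> ^ 2) -` {y} \<inter> (UNIV - {0}) \<subseteq> {\<tau>. poly [:- y, 0, a:] \<tau> = 0}"
      by (auto simp: power2_eq_square algebra_simps)
    moreover have "finite {\<tau>. poly [:- y, 0, a:] \<tau> = 0}"
      using a_nonzero by (intro poly_roots_finite) simp
    ultimately show False
      using y finite_subset by blast
  qed
  have "?c k0 = 0"
  proof (rule monomial_sum_eq_zero[OF finite_keys infinite_k \<open>infinite S\<close> infinite_k infinite_k _ _ k0])
    fix x y z w :: 'k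
    assume "y \<in> S"
    then obtain \<tau> where \<tau>: "y = a * \<tau> ^ 2" "\<tau> \<noteq> 0"
      by (auto simp: S_def)
    \<comment> \<open>Obtained by solving z = \<tau> (2 a t_y + b x) for t_y and w = y (2 t_z + b
      \<tau>) for t_z.\<close>
    define l where "l s = (case s of H1 \<Rightarrow> x | Hx \<Rightarrow> \<tau> | Hy \<Rightarrow> (z / \<tau> - b * x) / (2 * a)
      | Hz \<Rightarrow> (w / y - b * \<tau>) / 2)" for s
    have "y \<noteq> 0"
      using \<tau> a_nonzero by simp
    have X2: "point_eval l X2 = y"
      using \<tau> by (simp add: X2_def point_eval_mult point_eval_power point_eval_pconst point_eval_tvar l_def)
    have "point_eval l U = y * (2 * ((w / y - b * \<tau>) / 2) + b * \<tau>)"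
      unfolding U_def point_eval_mult point_eval_add X2 point_two
      by (simp add: point_eval_pconst point_eval_tvar l_def)
    also have "\<dots> = y * (w / y - b * \<tau> + b * \<tau>)"
      by (simp only: times_divide_eq_right nonzero_mult_div_cancel_left[OF two_k])
    also have "\<dots> = w"
      using \<open>y \<noteq> 0\<close> by simp
    finally have U: "point_eval l U = w" .
    have T: "point_eval l T = z" and t1: "point_eval l (tvar H1) = x"
      using \<tau> a_nonzero two_k by (simp_all add: T_def point_eval_mult point_eval_add
          point_eval_pconst point_eval_tvar point_two l_def)
    have "point_eval l p' = (\<Sum>k\<in>?K. ?c k * x ^ d1 k * y ^ d2 k * z ^ d3 k * w ^ d4 k)"
      by (simp add: p'_def point_eval_sum point_eval_mult point_eval_power point_eval_pconst X2 T U t1)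
    then show "(\<Sum>k\<in>?K. ?c k * x ^ d1 k * y ^ d2 k * z ^ d3 k * w ^ d4 k) = 0"
      by (simp add: \<open>p' = 0\<close> point_eval_zero)
  next
    show "inj_on (\<lambda>k. (d1 k, d2 k, d3 k, d4 k)) ?K"
    proof (rule inj_onI)
      fix k k'
      assume k: "k \<in> ?K" "k' \<in> ?K" "(d1 k, d2 k, d3 k, d4 k) = (d1 k', d2 k', d3 k', d4 k')"
      \<comment> \<open>The exponent of Y^2 is absent from the four, but it is 0 for both
        keys.\<close>
      have "fst (snd (snd k)) = 0" "fst (snd (snd k')) = 0"
        using assms(1) k by (simp_all add: no_Y2_def)
      with k D[OF k(1)] D[OF k(2)] show "k = k'"
        by (simp add: d1_def d2_def d3_def d4_def prod_eq_iff eq_nat_nat_iff)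
    qed
  qed
  with k0 show False
    by (simp add: in_keys_iff)
qed

text \<open>Modulo the relation \<open>p\<close> equals a normal form, on which \<open>ev\<close> is
  injective. So a vanishing value forces the normal form to be 0 and \<open>p\<close> to be a
  multiple of the relation.\<close>

lemma ev_kernel: "{p. ev p = 0} = Idl\<^bsub>Laur_alg\<^esub> {relation}"
proof -
  interpret L: cring "Laur_alg :: ('k, 'k Laur) module"
    unfolding Laur_alg_def by (rule cring_type_alg)
  note ev_mult = Laur_eval_mult[OF t_gen_nonzero gen_X2_nonzero]
  have "ev p = 0 \<longleftrightarrow> relation dvd p" for p
  proof
    assume p: "ev p = 0"
    obtain Q where "no_Y2 Q" "relation dvd L_Y2 - Q"
      by (rule relation_solves_Y2)
    then obtain p' where p': "no_Y2 p'" "relation dvd p - p'"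
      using Laur_reduce by blast
    then have "ev (p - p') = 0"
      by (auto simp: dvd_def ev_mult ev_relation)
    then have "ev p' = 0"
      using p by (simp add: Laur_eval_diff[OF t_gen_nonzero gen_X2_nonzero])
    then have "p' = 0"
      using p'(1) by (rule ev_eq_zero_imp_zero[rotated])
    with p'(2) show "relation dvd p" by simp
  qed (auto simp: dvd_def ev_mult ev_relation)
  then have "{p. ev p = 0} = PIdl\<^bsub>Laur_alg\<^esub> relation"
    by (auto simp: cgenideal_def Laur_alg_def type_alg_def dvd_def mult.commute)
  also have "\<dots> = Idl\<^bsub>Laur_alg\<^esub> {relation}"
    by (rule L.cgenideal_eq_genideal) (simp add: Laur_alg_def type_alg_def)
  finally show ?thesis .
qed

end

theorem theorem10p3:
  fixes a b c :: "'k::field"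
  assumes "infinite (UNIV :: 'k set)"
    and "CHAR('k) \<noteq> 2"
    and "a \<noteq> 0"
  shows "let e = ident a b c (U_E a b c); x2 = ident a b c (U_X2 a b c);
             y2 = ident a b c (U_Y2 a b c); tt = ident a b c (U_T a b c);
             uu = ident a b c (U_U a b c);
             S = submonoid_gen (ZH_alg a b c) {U_E a b c, U_X2 a b c}
         in BH a b c = alg_gen KH_alg {e, inverse e, x2, inverse x2, y2, tt, uu} \<and>
            (\<exists>\<phi> \<in> alg_iso (loc_alg (ZH_alg a b c) S) (BH_alg a b c).
               \<forall>z \<in> carrier (ZH_alg a b c).
                 \<phi> (loc_frac (ZH_alg a b c) S z \<one>\<^bsub>ZH_alg a b c\<^esub>) = ident a b c z) \<and>
            {p. Laur_eval e x2 y2 tt uu p = 0} =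
              Idl\<^bsub>Laur_alg\<^esub> {L_T ^ 2 - 4 * L_X2 * L_Y2
                - pconst ((b ^ 2 - 4 * a * c) / a) * L_E ^ 2 * L_X2}"
proof -
  interpret sweedler_cocycle a b c
    using assms by unfold_locales
  show ?thesis
    unfolding Let_def ident_generators
    by (intro conjI BH_eq_BB[unfolded BB_def] BH_iso_localization ev_kernel[unfolded relation_def])
qed

end
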